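(* Let $n\geq 1$ be an integer and let $(\lambda_1,\dots,\lambda_k)$ be a partition of $n$. Each connected component of the subgraph of $\mathcal{M}(K_{2n})$ induced by the vertices with type $(\lambda_1,\dots,\lambda_k)$ is isomorphic to the graph $\mathrm{SR}_{\lambda_1-1}\mathbin{\square}\cdots\mathbin{\square}\mathrm{SR}_{\lambda_k-1}$.
   Context: $K_{2n}$ is the complete graph on the $2n$ vertices $0^{+},0^{-},1^{+},1^{-},\dots,(n-1)^{+},(n-1)^{-}$. The flip graph $\mathcal{M}(K_{2n})$ is the graph whose vertices are the perfect matchings of $K_{2n}$, where two perfect matchings are adjacent if their symmetric difference (as edge sets) is a cycle of length $4$. The identity perfect matching is $M_0=\{\{0^{+},0^{-}\},\dots,\{(n-1)^{+},(n-1)^{-}\}\}$. For a perfect matching $M$, the multigraph union $M_0\cup M$ is a disjoint union of cycles of even lengths $2\lambda_1\geq\cdots\geq 2\lambda_k$ (an edge lying in both $M_0$ and $M$ gives a cycle of length $2$); the partition $(\lambda_1,\dots,\lambda_k)$ of $n$ is called the type of $M$. For $k\geq 1$, a signed permutation of degree $k$ is a $k$-tuple $(\sigma_1,\dots,\sigma_k)$ of integers such that $(|\sigma_1|,\dots,|\sigma_k|)$ is a permutation of $\{1,\dots,k\}$. The signed reversal graph $\mathrm{SR}_k$ is the graph whose vertices are the signed permutations of degree $k$, where $\sigma=(\sigma_1,\dots,\sigma_k)$ and $\tau=(\tau_1,\dots,\tau_k)$ are adjacent if there exist $1\leq i\leq j\leq k$ such that $(\tau_1,\dots,\tau_k)=(\sigma_1,\dots,\sigma_{i-1},-\sigma_j,-\sigma_{j-1},\dots,-\sigma_i,\sigma_{j+1},\dots,\sigma_k)$.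 By convention $\mathrm{SR}_0$ is the graph with one vertex and no edges. $G\mathbin{\square}H$ denotes the Cartesian product of graphs: its vertex set is $V(G)\times V(H)$, and $(g_1,h_1)\sim(g_2,h_2)$ if $g_1\sim g_2$ in $G$ and $h_1=h_2$, or $g_1=g_2$ and $h_1\sim h_2$ in $H$; this is extended to more factors by associativity. *)

theory Defs
  imports
    "Graph_Theory.Digraph_Component"
    "Graph_Theory.Digraph_Isomorphism"
    "HOL-Combinatorics.Multiset_Permutations"
begin

text \<open>
  As in the library, an undirected simple graph is a symmetric, loop-free digraph without parallel
  arcs, that is, a \<open>pair_graph\<close>: an edge \<open>{u,v}\<close> is the pair of arcs \<open>(u,v)\<close> and \<open>(v,u)\<close>.
  In such a graph the strongly connected components \<open>sccs\<close> are the connected components.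
\<close>

definition edges :: "'a pair_pre_digraph \<Rightarrow> 'a set set" where
  "edges G = {{u, v} | u v. (u, v) \<in> parcs G}"

definition perfect_matching :: "'a pair_pre_digraph \<Rightarrow> 'a set set \<Rightarrow> bool" where
  "perfect_matching G M \<longleftrightarrow> M \<subseteq> edges G \<and> (\<forall>v\<in>pverts G. \<exists>!e. e \<in> M \<and> v \<in> e)"

definition four_cycle :: "'a set set \<Rightarrow> bool" where
  "four_cycle E \<longleftrightarrow> (\<exists>a b c d. distinct [a, b, c, d] \<and> E = {{a, b}, {b, c}, {c, d}, {d, a}})"

definition flip_graph :: "'a pair_pre_digraph \<Rightarrow> 'a set set pair_pre_digraph" where
  "flip_graph G =
    \<lparr>pverts = {M. perfect_matching G M},
     parcs = {(M, M'). perfect_matching G M \<and> perfect_matching G M' \<and> four_cycle (sym_diff M M')}\<rparr>"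


text \<open>The vertices \<open>i\<^sup>+\<close> and \<open>i\<^sup>-\<close> are \<open>(i, True)\<close> and \<open>(i, False)\<close>.\<close>

type_synonym vertex = "nat \<times> bool"

definition complete_graph_2n :: "nat \<Rightarrow> vertex pair_pre_digraph" where
  "complete_graph_2n n =
    \<lparr>pverts = {..<n} \<times> UNIV,
     parcs = {(u, v). u \<in> {..<n} \<times> UNIV \<and> v \<in> {..<n} \<times> UNIV \<and> u \<noteq> v}\<rparr>"

definition identity_matching :: "nat \<Rightarrow> vertex set set" where
  "identity_matching n = {{(i, True), (i, False)} | i. i < n}"

text \<open>
  Every vertex lies on exactly one edge of \<open>M\<^sub>0\<close> and exactly one edge of a perfect matching \<open>M\<close>, so
  the multigraph union of \<open>M\<^sub>0\<close> and \<open>M\<close> is 2-regular and its cycles are its connected components.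
  The simple graph \<open>union_graph\<close>, which forgets multiplicities, has the same components; the length
  of a cycle is the number of its edges in the multiset union of \<open>M\<^sub>0\<close> and \<open>M\<close>, so that a common
  edge counts twice.
\<close>

definition union_graph :: "nat \<Rightarrow> vertex set set \<Rightarrow> vertex pair_pre_digraph" where
  "union_graph n M =
    \<lparr>pverts = {..<n} \<times> UNIV, parcs = {(u, v). {u, v} \<in> identity_matching n \<union> M}\<rparr>"

definition cycle_length :: "nat \<Rightarrow> vertex set set \<Rightarrow> vertex set \<Rightarrow> nat" where
  "cycle_length n M S =
    size {#e \<in># mset_set (identity_matching n) + mset_set M. e \<subseteq> S#}"

definition matching_type :: "nat \<Rightarrow> vertex set set \<Rightarrow> nat list" where
  "matching_type n M =
    rev (sorted_list_of_multiset
      {#cycle_length n M S div 2.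
          S \<in># mset_set (pre_digraph.sccs_verts (with_proj (union_graph n M)))#})"

definition is_partition :: "nat \<Rightarrow> nat list \<Rightarrow> bool" where
  "is_partition n ls \<longleftrightarrow> sorted_wrt (\<ge>) ls \<and> (\<forall>l\<in>set ls. 1 \<le> l) \<and> sum_list ls = n"


definition signed_perms :: "nat \<Rightarrow> int list set" where
  "signed_perms k = {\<sigma>. map abs \<sigma> \<in> permutations_of_set {1..int k}}"

text \<open>Positions \<open>i\<close> and \<open>j\<close> are counted from 1.\<close>

definition signed_reversal :: "nat \<Rightarrow> nat \<Rightarrow> int list \<Rightarrow> int list" where
  "signed_reversal i j \<sigma> =
    take (i - 1) \<sigma> @ map uminus (rev (drop (i - 1) (take j \<sigma>))) @ drop j \<sigma>"

definition SR :: "nat \<Rightarrow> int list pair_pre_digraph" where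
  "SR k =
    \<lparr>pverts = signed_perms k,
     parcs = {(\<sigma>, \<tau>). \<sigma> \<in> signed_perms k \<and> \<tau> \<in> signed_perms k \<and>
                (\<exists>i j. 1 \<le> i \<and> i \<le> j \<and> j \<le> k \<and> \<tau> = signed_reversal i j \<sigma>)}\<rparr>"


definition box_prod ::
  "'a pair_pre_digraph \<Rightarrow> 'b pair_pre_digraph \<Rightarrow> ('a \<times> 'b) pair_pre_digraph" where
  "box_prod G H =
    \<lparr>pverts = pverts G \<times> pverts H,
     parcs = {((g1, h1), (g2, h2)).
        (g1, g2) \<in> parcs G \<and> h1 \<in> pverts H \<and> h1 = h2 \<or>
        g1 \<in> pverts G \<and> g1 = g2 \<and> (h1, h2) \<in> parcs H}\<rparr>"

definition relabel :: "('a \<Rightarrow> 'b) \<Rightarrow> 'a pair_pre_digraph \<Rightarrow> 'b pair_pre_digraph" where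
  "relabel f G = \<lparr>pverts = f ` pverts G, parcs = map_prod f f ` parcs G\<rparr>"

text \<open>
  Iterated product. The nested pairs \<open>(g\<^sub>1, (g\<^sub>2, \<dots>))\<close> are written as lists \<open>[g\<^sub>1, g\<^sub>2, \<dots>]\<close>, so that
  the type does not depend on the number of factors; the product of no factors is a single vertex.
\<close>

primrec box_prod_list :: "'a pair_pre_digraph list \<Rightarrow> 'a list pair_pre_digraph" where
  "box_prod_list [] = \<lparr>pverts = {[]}, parcs = {}\<rparr>"
| "box_prod_list (G # Gs) = relabel (\<lambda>(g, gs). g # gs) (box_prod G (box_prod_list Gs))"


text \<open>The graphs above are undirected simple graphs in the sense of the library.\<close>

lemma pair_graph_complete_graph_2n: "pair_graph (complete_graph_2n n)"
proof
  have "finite ({..<n} \<times> (UNIV::bool set))" by simp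
  then have "finite (({..<n} \<times> (UNIV::bool set)) \<times> ({..<n} \<times> (UNIV::bool set)))"
    by blast
  then show "finite (parcs (complete_graph_2n n))"
    by (rule rev_finite_subset) (auto simp: complete_graph_2n_def)
qed (auto simp: complete_graph_2n_def symmetric_def sym_def)

lemma pair_graph_flip_graph:
  assumes "pair_graph G"
  shows "pair_graph (flip_graph G)"
proof -
  interpret pair_graph G by fact
  have "edges G \<subseteq> Pow (pverts G)"
    unfolding edges_def using wellformed' by blast
  then have fin: "finite {M. perfect_matching G M}"
    by (rule_tac finite_subset[of _ "Pow (Pow (pverts G))"])
      (auto simp: perfect_matching_def pair_finite_verts)
  show ?thesis
  proof
    have "finite ({M. perfect_matching G M} \<times> {M. perfect_matching G M})"
      using fin by blast
    then show "finite (parcs (flip_graph G))"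
      by (rule rev_finite_subset) (auto simp: flip_graph_def)
  next
    show "symmetric (with_proj (flip_graph G))"
      by (auto simp: symmetric_def sym_def flip_graph_def Un_commute)
  next
    have "\<not> four_cycle (sym_diff M M)" for M :: "'a set set"
      by (simp add: four_cycle_def)
    then show "fst e \<noteq> snd e" if "e \<in> parcs (flip_graph G)" for e
      using that by (auto simp: flip_graph_def simp del: Diff_cancel)
  qed (use fin in \<open>auto simp: flip_graph_def\<close>)
qed

lemma signed_reversal_split:
  assumes "1 \<le> i" "i \<le> j" "j \<le> length \<sigma>"
  obtains xs ys zs where "\<sigma> = xs @ ys @ zs" "length xs = i - 1" "length ys = j - (i - 1)"
    "signed_reversal i j \<sigma> = xs @ map uminus (rev ys) @ zs"
proof
  show "\<sigma> = take (i - 1) \<sigma> @ drop (i - 1) (take j \<sigma>) @ drop j \<sigma>"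
    using assms by (metis append.assoc append_take_drop_id diff_le_self le_trans min.absorb1 take_take)
qed (use assms in \<open>auto simp: signed_reversal_def\<close>)

lemma signed_reversal_involution:
  assumes "1 \<le> i" "i \<le> j" "j \<le> length \<sigma>"
  shows "signed_reversal i j (signed_reversal i j \<sigma>) = \<sigma>"
proof -
  obtain xs ys zs where *: "\<sigma> = xs @ ys @ zs" "length xs = i - 1" "length ys = j - (i - 1)"
    "signed_reversal i j \<sigma> = xs @ map uminus (rev ys) @ zs"
    using signed_reversal_split[OF assms] .
  have "length xs + length ys = j" using * assms by simp
  then show ?thesis unfolding *(4) using * assms
    by (simp add: signed_reversal_def rev_map o_def)
qed

lemma signed_reversal_signed_perms:
  assumes "1 \<le> i" "i \<le> j" "j \<le> length \<sigma>" "\<sigma> \<in> signed_perms k"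
  shows "signed_reversal i j \<sigma> \<in> signed_perms k"
proof -
  obtain xs ys zs where *: "\<sigma> = xs @ ys @ zs"
    "signed_reversal i j \<sigma> = xs @ map uminus (rev ys) @ zs"
    using signed_reversal_split[OF assms(1-3)] by metis
  have "mset (map abs (signed_reversal i j \<sigma>)) = mset (map abs \<sigma>)"
    unfolding *(2) by (simp add: *(1) multiset.map_comp o_def)
  then show ?thesis using assms(4) unfolding signed_perms_def permutations_of_set_def
    by (metis (mono_tags, lifting) mem_Collect_eq mset_eq_imp_distinct_iff mset_eq_setD)
qed

lemma length_signed_perms: "\<sigma> \<in> signed_perms k \<Longrightarrow> length \<sigma> = k"
  unfolding signed_perms_def
  by (metis card_atLeastAtMost_int diff_add_cancel length_finite_permutations_of_set length_map
      mem_Collect_eq nat_int add_diff_cancel_right')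

lemma signed_reversal_neq:
  assumes "1 \<le> i" "i \<le> j" "j \<le> length \<sigma>" "\<sigma> \<in> signed_perms k"
  shows "signed_reversal i j \<sigma> \<noteq> \<sigma>"
proof
  assume eq: "signed_reversal i j \<sigma> = \<sigma>"
  obtain xs ys zs where *: "\<sigma> = xs @ ys @ zs" "length xs = i - 1" "length ys = j - (i - 1)"
    "signed_reversal i j \<sigma> = xs @ map uminus (rev ys) @ zs"
    using signed_reversal_split[OF assms(1-3)] .
  have m: "map uminus (rev ys) = ys" using eq * by simp
  have "ys \<noteq> []" using * assms by auto
  then obtain y ys' where ys: "ys = y # ys'" by (cases ys) auto
  have p: "abs ` set \<sigma> = {1..int k}" "distinct (map abs \<sigma>)"
    using assms(4) by (auto simp: signed_perms_def permutations_of_set_def)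
  have "0 \<notin> abs ` set \<sigma>" unfolding p(1) by simp
  then have d: "distinct (map abs ys)" "0 \<notin> set ys"
    using p(2) unfolding *(1) by (auto simp: image_iff)
  have "last (map uminus (rev ys)) = - y" by (simp add: ys)
  then have "last ys = - y" using m by simp
  then show False using d ys by (cases ys' rule: rev_cases) auto
qed

lemma pair_graph_SR: "pair_graph (SR k)"
proof
  have "signed_perms k \<subseteq> {xs. set xs \<subseteq> {- int k..int k} \<and> length xs = k}"
  proof
    fix \<sigma> assume \<sigma>: "\<sigma> \<in> signed_perms k"
    then have "abs ` set \<sigma> = {1..int k}"
      by (simp add: signed_perms_def permutations_of_set_def)
    then have "\<bar>x\<bar> \<le> int k" if "x \<in> set \<sigma>" for x using that by auto
    then have "set \<sigma> \<subseteq> {- int k..int k}" by (fastforce simp: abs_le_iff)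
    then show "\<sigma> \<in> {xs. set xs \<subseteq> {- int k..int k} \<and> length xs = k}"
      using length_signed_perms[OF \<sigma>] by simp
  qed
  then have fin: "finite (signed_perms k)"
    by (rule finite_subset) (simp add: finite_lists_length_eq)
  then show "finite (pverts (SR k))" by (simp add: SR_def)
  have "finite (signed_perms k \<times> signed_perms k)" using fin by blast
  then show "finite (parcs (SR k))"
    by (rule rev_finite_subset) (auto simp: SR_def)
  show "symmetric (with_proj (SR k))"
    unfolding symmetric_def sym_def
  proof (intro allI impI)
    fix \<sigma> \<tau> assume "(\<sigma>, \<tau>) \<in> arcs_ends (with_proj (SR k))"
    then obtain i j where *: "\<sigma> \<in> signed_perms k" "\<tau> \<in> signed_perms k"
        "1 \<le> i" "i \<le> j" "j \<le> k" "\<tau> = signed_reversal i j \<sigma>"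
      by (auto simp: SR_def)
    then have "\<sigma> = signed_reversal i j \<tau>"
      using signed_reversal_involution length_signed_perms by simp
    then show "(\<tau>, \<sigma>) \<in> arcs_ends (with_proj (SR k))"
      using * by (auto simp: SR_def)
  qed
  show "fst e \<noteq> snd e" if "e \<in> parcs (SR k)" for e
    using that signed_reversal_neq length_signed_perms by (fastforce simp: SR_def)
qed (auto simp: SR_def)

lemma pair_graph_box_prod:
  assumes "pair_graph G" "pair_graph H"
  shows "pair_graph (box_prod G H)"
proof -
  interpret G: pair_graph G by fact
  interpret H: pair_graph H by fact
  have fin: "finite (pverts (box_prod G H))"
    by (simp add: box_prod_def G.pair_finite_verts H.pair_finite_verts)
  show ?thesis
  proof
    have "finite (pverts (box_prod G H) \<times> pverts (box_prod G H))" using fin by blast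
    then show "finite (parcs (box_prod G H))"
      by (rule rev_finite_subset) (auto simp: box_prod_def dest: G.wellformed' H.wellformed')
    show "symmetric (with_proj (box_prod G H))"
      using G.pair_sym_arcs H.pair_sym_arcs G.wellformed' H.wellformed'
      by (auto simp: symmetric_def sym_def box_prod_def)
  qed (use fin G.pair_no_loops H.pair_no_loops in
      \<open>auto simp: box_prod_def dest: G.wellformed' H.wellformed'\<close>)
qed

lemma pair_graph_relabel:
  assumes "pair_graph G" "inj f"
  shows "pair_graph (relabel f G)"
proof -
  interpret G: pair_graph G by fact
  show ?thesis
  proof
    show "symmetric (with_proj (relabel f G))"
      using G.pair_sym_arcs by (fastforce simp: symmetric_def sym_def relabel_def)
    show "fst e \<noteq> snd e" if "e \<in> parcs (relabel f G)" for e
      using that G.pair_no_loops \<open>inj f\<close> by (fastforce simp: relabel_def dest: injD)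
  qed (auto simp: relabel_def G.pair_finite_verts G.pair_finite_arcs dest: G.wellformed')
qed

lemma pair_graph_box_prod_list:
  assumes "\<forall>G\<in>set Gs. pair_graph G"
  shows "pair_graph (box_prod_list Gs)"
  using assms
proof (induction Gs)
  case Nil
  show ?case by unfold_locales (auto simp: symmetric_def sym_def)
next
  case (Cons G Gs)
  have "inj (\<lambda>(g :: 'a, gs). g # gs)" by (auto simp: inj_def)
  then show ?case using Cons by (simp add: pair_graph_relabel pair_graph_box_prod)
qed

lemma pair_graph_union_graph:
  assumes "perfect_matching (complete_graph_2n n) M"
  shows "pair_graph (union_graph n M)"
proof -
  have "u \<in> {..<n} \<times> UNIV \<and> v \<in> {..<n} \<times> UNIV \<and> u \<noteq> v"
    if "{u, v} \<in> identity_matching n \<union> M" for u v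
  proof -
    have "{(i, True), (i, False)} \<in> edges (complete_graph_2n n)" if "i < n" for i
      unfolding edges_def mem_Collect_eq
      by (intro exI[of _ "(i, True)"] exI[of _ "(i, False)"])
        (use that in \<open>simp add: complete_graph_2n_def\<close>)
    then have "identity_matching n \<union> M \<subseteq> edges (complete_graph_2n n)"
      using assms by (auto simp: perfect_matching_def identity_matching_def)
    from subsetD[OF this that]
    obtain a b where "{u, v} = {a, b}" "(a, b) \<in> parcs (complete_graph_2n n)"
      unfolding edges_def mem_Collect_eq by (elim exE conjE)
    then show ?thesis
      unfolding doubleton_eq_iff by (auto simp: complete_graph_2n_def)
  qed
  then have sub: "parcs (union_graph n M) \<subseteq> parcs (complete_graph_2n n)"
    by (auto simp: union_graph_def complete_graph_2n_def)
  interpret K: pair_graph "complete_graph_2n n" by (rule pair_graph_complete_graph_2n)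
  have verts: "pverts (union_graph n M) = pverts (complete_graph_2n n)"
    by (simp add: union_graph_def complete_graph_2n_def)
  show ?thesis
  proof
    have "{u, v} = {v, u}" for u v :: vertex by blast
    then show "symmetric (with_proj (union_graph n M))"
      unfolding symmetric_def sym_def union_graph_def by (metis (no_types, lifting)
          case_prod_conv mem_Collect_eq pair_pre_digraph.select_convs(2) with_proj_simps(3))
    show "finite (parcs (union_graph n M))"
      using sub K.pair_finite_arcs by (rule finite_subset)
    show "fst e \<noteq> snd e" if "e \<in> parcs (union_graph n M)" for e
      using that sub K.pair_no_loops by blast
    show "fst e \<in> pverts (union_graph n M)" if "e \<in> parcs (union_graph n M)" for e
      using that sub K.arc_fst_in_verts unfolding verts by blast
    show "snd e \<in> pverts (union_graph n M)" if "e \<in> parcs (union_graph n M)" for e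
      using that sub K.arc_snd_in_verts unfolding verts by blast
  qed (simp add: verts K.pair_finite_verts)
qed

end

theory Submission
  imports Defs
begin

text \<open>
  A walk along a cycle of \<open>M\<^sub>0 \<union> M\<close> uses edges of \<open>M\<^sub>0\<close> and of \<open>M\<close> alternately, so the cycle is
  recorded by the cyclic sequence of its \<open>M\<^sub>0\<close>-edges, each with the direction in which it is traversed.
  A traversed \<open>M\<^sub>0\<close>-edge is written as a dart, the vertex at which the walk enters it, and a matching is
  encoded by one list of darts for each cycle (\<open>cycle_system\<close>, \<open>matching_of\<close>).

  A flip replaces two edges of \<open>M\<close> by another pairing of their four ends. If the two edges lie on
  different cycles, the cycles merge. If they lie on one cycle, they cut it into two arcs; one of the
  two other pairings closes up each arc to a cycle of its own, and the other one reverses one arc.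
  Merging and splitting change the number of cycles and hence the type, so the only flips between
  matchings of equal type are reversals of arcs (\<open>flip_of_cycle_system\<close>). In particular each cycle keeps
  its vertex set, and the cycles change independently of each other.

  Up to rotation and a change of direction, a cycle with \<open>l\<close> darts can be read from a fixed starting
  dart; the other \<open>l - 1\<close> darts then form a list which, relative to the list of one reference matching,
  is a signed permutation of degree \<open>l - 1\<close>, the sign telling the direction of traversal. Reversing an
  arc gives the same matching as reversing the complementary arc, so only arcs that avoid the
  starting dart matter, and these are reversed by signed reversals. This yields a map from the product of the signed
  reversal graphs to matchings of the given type. It is injective, because a matching forces every
  step of the walk from the starting dart (\<open>cycle_system_determined\<close>); its arcs correspond to the flips
  (\<open>arc_is_flip\<close>, \<open>flip_is_arc\<close>); and since signed reversals connect all signed permutations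
  (\<open>reversal_step_connected\<close>), its image is a whole component.

  That each matching arises from a cycle system also follows from the analysis of flips: the
  identity matching is encoded by cycles with a single dart, every matching is reached from it by
  flips, and a flip of an encoded matching is again encoded (\<open>cycle_system_of_matching\<close>).
\<close>

section \<open>Perfect matchings of a vertex set\<close>

definition matching_on :: "'v set \<Rightarrow> 'v set set \<Rightarrow> bool" where
  "matching_on V E \<longleftrightarrow>
     (\<forall>e\<in>E. e \<subseteq> V \<and> (\<exists>a b. a \<noteq> b \<and> e = {a, b})) \<and> (\<forall>v\<in>V. \<exists>!e. e \<in> E \<and> v \<in> e)"

lemma matching_onE:
  assumes "matching_on V E" "e \<in> E"
  obtains a b where "a \<noteq> b" "e = {a, b}" "a \<in> V" "b \<in> V"
proof -
  have "e \<subseteq> V \<and> (\<exists>a b. a \<noteq> b \<and> e = {a, b})" using assms unfolding matching_on_def by simp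
  then show ?thesis using that by (elim conjE exE) simp
qed

lemma matching_on_same_edge:
  assumes "matching_on V E" "e \<in> E" "f \<in> E" "v \<in> e" "v \<in> f"
  shows "e = f"
  using assms unfolding matching_on_def by blast

lemma matching_on_partner:
  assumes "matching_on V E" "{a, b} \<in> E" "{a, c} \<in> E"
  shows "b = c"
  using matching_on_same_edge[OF assms, of a] by (auto simp: doubleton_eq_iff)

lemma matching_on_distinct_ends:
  assumes "matching_on V E" "{a, b} \<in> E"
  shows "a \<noteq> b"
  by (rule matching_onE[OF assms]) (auto simp: doubleton_eq_iff)

lemma matching_on_Union:
  assumes "matching_on V E"
  shows "\<Union> E = V"
proof (intro equalityI subsetI)
  fix v assume "v \<in> \<Union> E"
  then obtain e where "e \<in> E" "v \<in> e" by blast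
  then show "v \<in> V" using assms by (auto simp: matching_on_def)
next
  fix v assume "v \<in> V"
  then have "\<exists>!e. e \<in> E \<and> v \<in> e" using assms by (simp add: matching_on_def)
  then show "v \<in> \<Union> E" by blast
qed

lemma matching_on_covered:
  assumes "matching_on V E" "v \<in> V"
  obtains w where "{v, w} \<in> E" "w \<in> V" "v \<noteq> w"
proof -
  obtain e where e: "e \<in> E" "v \<in> e"
    using assms unfolding matching_on_def by blast
  obtain a b where "a \<noteq> b" "e = {a, b}" "a \<in> V" "b \<in> V"
    using matching_onE[OF assms(1) e(1)] .
  then show ?thesis using that[of a] that[of b] e by (auto simp: insert_commute)
qed

text \<open>
  Since both sets of edges cover every vertex exactly once, neither can be enlarged. This turns each
  identification of a flipped matching below into a proof of one inclusion.
\<close>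

lemma matching_on_subset_eq:
  assumes "matching_on V E" "matching_on V F" "E \<subseteq> F"
  shows "E = F"
proof
  show "F \<subseteq> E"
  proof
    fix f assume f: "f \<in> F"
    then obtain a b where ab: "f = {a, b}" "a \<in> V" using matching_onE[OF assms(2)] by metis
    then obtain e where "e \<in> E" "a \<in> e" using assms(1) unfolding matching_on_def by blast
    then show "f \<in> E" using matching_on_same_edge[OF assms(2) f, of e a] assms(3) ab by auto
  qed
qed (fact assms(3))

lemma matching_on_empty: "matching_on {} {}"
  by (simp add: matching_on_def)

lemma matching_on_insert:
  assumes "matching_on V E" "a \<noteq> b" "a \<notin> V" "b \<notin> V"
  shows "matching_on (insert a (insert b V)) (insert {a, b} E)"
proof -
  have sub: "e \<subseteq> V" if "e \<in> E" for e using assms(1) that unfolding matching_on_def by blast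
  show ?thesis
    unfolding matching_on_def
  proof (intro conjI ballI)
    fix v assume v: "v \<in> insert a (insert b V)"
    show "\<exists>!e. e \<in> insert {a, b} E \<and> v \<in> e"
    proof (cases "v \<in> V")
      case True
      then have "\<exists>!e. e \<in> E \<and> v \<in> e" using assms(1) unfolding matching_on_def by blast
      then show ?thesis using True assms(3,4) by auto
    next
      case False
      then show ?thesis using v sub by (intro ex1I[of _ "{a, b}"]) auto
    qed
  next
    fix e assume e: "e \<in> insert {a, b} E"
    then show "e \<subseteq> insert a (insert b V)" using sub by auto
    show "\<exists>x y. x \<noteq> y \<and> e = {x, y}"
    proof (cases "e = {a, b}")
      case False
      then show ?thesis using e matching_onE[OF assms(1), of e] by (metis insertE)
    qed (use assms(2) in auto)
  qed
qed

lemma matching_on_UN: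
  assumes "\<And>x. x \<in> X \<Longrightarrow> matching_on (V x) (E x)"
    and "\<And>x y. x \<in> X \<Longrightarrow> y \<in> X \<Longrightarrow> x \<noteq> y \<Longrightarrow> V x \<inter> V y = {}"
  shows "matching_on (\<Union>x\<in>X. V x) (\<Union>x\<in>X. E x)"
  unfolding matching_on_def
proof (intro conjI ballI)
  fix v assume "v \<in> (\<Union>x\<in>X. V x)"
  then obtain x where x: "x \<in> X" "v \<in> V x" by blast
  then obtain e where e: "e \<in> E x" "v \<in> e" using assms(1) unfolding matching_on_def by blast
  show "\<exists>!e. e \<in> (\<Union>x\<in>X. E x) \<and> v \<in> e"
  proof (rule ex1I[of _ e])
    fix f assume "f \<in> (\<Union>x\<in>X. E x) \<and> v \<in> f"
    then obtain y where y: "y \<in> X" "f \<in> E y" "v \<in> f" by blast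
    then have "v \<in> V y" using assms(1) unfolding matching_on_def by blast
    then have "y = x" using assms(2) x y by blast
    then show "f = e" using y e matching_on_same_edge[OF assms(1)[OF x(1)]] by blast
  qed (use x e in blast)
next
  fix e assume "e \<in> (\<Union>x\<in>X. E x)"
  then show "e \<subseteq> (\<Union>x\<in>X. V x)" "\<exists>x y. x \<noteq> y \<and> e = {x, y}"
    using assms(1) unfolding matching_on_def by blast+
qed

lemma card_matching_on:
  assumes "matching_on V E" "finite V"
  shows "finite E" "2 * card E = card V"
proof -
  have sub: "E \<subseteq> Pow V" using assms(1) unfolding matching_on_def by blast
  then show fin: "finite E" using assms(2) finite_subset by blast
  have "2 * card E = card (\<Union> E)"
  proof (rule card_partition)
    show "finite (\<Union> E)" using matching_on_Union[OF assms(1)] assms(2) by simp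
    show "card e = 2" if "e \<in> E" for e
      using matching_onE[OF assms(1) that] by (metis card_2_iff)
    show "e \<inter> f = {}" if "e \<in> E" "f \<in> E" "e \<noteq> f" for e f
      using matching_on_same_edge[OF assms(1) that(1,2)] that(3) by blast
  qed (fact fin)
  then show "2 * card E = card V" using matching_on_Union[OF assms(1)] by simp
qed

lemma matching_on_restrict:
  assumes "matching_on V E" "S \<subseteq> V" "\<And>e. e \<in> E \<Longrightarrow> e \<inter> S \<noteq> {} \<Longrightarrow> e \<subseteq> S"
  shows "matching_on S {e \<in> E. e \<subseteq> S}"
  unfolding matching_on_def
proof (intro conjI ballI)
  fix v assume v: "v \<in> S"
  then obtain e where e: "e \<in> E" "v \<in> e" using assms(1,2) unfolding matching_on_def by blast
  show "\<exists>!e. e \<in> {e \<in> E. e \<subseteq> S} \<and> v \<in> e"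
  proof (rule ex1I[of _ e])
    show "e \<in> {e \<in> E. e \<subseteq> S} \<and> v \<in> e" using e v assms(3)[of e] by blast
    show "f = e" if "f \<in> {e \<in> E. e \<subseteq> S} \<and> v \<in> f" for f
      using that e matching_on_same_edge[OF assms(1)] by blast
  qed
next
  fix e assume "e \<in> {e \<in> E. e \<subseteq> S}"
  then show "e \<subseteq> S" "\<exists>x y. x \<noteq> y \<and> e = {x, y}"
    using assms(1) unfolding matching_on_def by blast+
qed

lemma perfect_matching_complete_graph_2n:
  "perfect_matching (complete_graph_2n n) M \<longleftrightarrow> matching_on ({..<n} \<times> UNIV) M"
proof -
  let ?V = "{..<n} \<times> (UNIV :: bool set)"
  have "edges (complete_graph_2n n) = {{u, v} | u v. u \<in> ?V \<and> v \<in> ?V \<and> u \<noteq> v}"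
    unfolding edges_def complete_graph_2n_def by simp
  then have "e \<in> edges (complete_graph_2n n) \<longleftrightarrow> (\<exists>a b. e = {a, b} \<and> a \<in> ?V \<and> b \<in> ?V \<and> a \<noteq> b)" for e
    by (simp only: mem_Collect_eq)
  moreover have "(e = {a, b} \<and> a \<in> ?V \<and> b \<in> ?V \<and> a \<noteq> b) \<longleftrightarrow> (e \<subseteq> ?V \<and> a \<noteq> b \<and> e = {a, b})" for a b e
    by auto
  ultimately have "e \<in> edges (complete_graph_2n n) \<longleftrightarrow> e \<subseteq> ?V \<and> (\<exists>a b. a \<noteq> b \<and> e = {a, b})" for e
    by (simp only: ex_simps)
  then have "M \<subseteq> edges (complete_graph_2n n) \<longleftrightarrow>
      (\<forall>e\<in>M. e \<subseteq> ?V \<and> (\<exists>a b. a \<noteq> b \<and> e = {a, b}))" by (simp only: subset_eq)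
  then show ?thesis
    unfolding perfect_matching_def matching_on_def by (simp add: complete_graph_2n_def)
qed

section \<open>Flips\<close>

text \<open>
  Two consecutive edges of the 4-cycle share a vertex, so they cannot both belong to the same matching:
  its edges alternate between the two matchings.
\<close>

lemma four_cycle_sym_diff_exchange:
  assumes "matching_on V M" "matching_on V M'" "four_cycle (sym_diff M M')"
  obtains a b c d where "{a, b} \<in> M" "{c, d} \<in> M" "{a, b} \<noteq> {c, d}"
    "M' = M - {{a, b}, {c, d}} \<union> {{b, c}, {d, a}}"
proof -
  obtain a b c d where abcd: "distinct [a, b, c, d]"
      and E: "sym_diff M M' = {{a, b}, {b, c}, {c, d}, {d, a}}"
    using assms(3) unfolding four_cycle_def by metis
  have in_diff: "(e \<in> M \<and> e \<notin> M') \<or> (e \<in> M' \<and> e \<notin> M)" if "e \<in> {{a, b}, {b, c}, {c, d}, {d, a}}" for e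
    using that unfolding E[symmetric] by blast
  have not_both: "\<not> ({x, y} \<in> N \<and> {y, z} \<in> N)" if "x \<noteq> z" "matching_on V N" for x y z N
    using matching_on_partner[OF that(2), of y x z] that(1) by (auto simp: insert_commute)
  have *: "M' = (M - (sym_diff M M')) \<union> (sym_diff M M' - M)" by blast
  have ne: "a \<noteq> c" "b \<noteq> d" "c \<noteq> a" "d \<noteq> b" using abcd by auto
  have sep: "\<not> ({a, b} \<in> N \<and> {b, c} \<in> N)" "\<not> ({b, c} \<in> N \<and> {c, d} \<in> N)"
      "\<not> ({c, d} \<in> N \<and> {d, a} \<in> N)" if "matching_on V N" for N
    using not_both[OF ne(1) that] not_both[OF ne(2) that] not_both[OF ne(3) that] by metis+
  have "{a, b} \<in> M \<and> {a, b} \<notin> M' \<or> {a, b} \<in> M' \<and> {a, b} \<notin> M"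
      "{b, c} \<in> M \<and> {b, c} \<notin> M' \<or> {b, c} \<in> M' \<and> {b, c} \<notin> M"
      "{c, d} \<in> M \<and> {c, d} \<notin> M' \<or> {c, d} \<in> M' \<and> {c, d} \<notin> M"
      "{d, a} \<in> M \<and> {d, a} \<notin> M' \<or> {d, a} \<in> M' \<and> {d, a} \<notin> M"
    by (rule in_diff; simp)+
  then have alt: "{a, b} \<in> M \<longleftrightarrow> {b, c} \<notin> M" "{b, c} \<in> M \<longleftrightarrow> {c, d} \<notin> M"
      "{c, d} \<in> M \<longleftrightarrow> {d, a} \<notin> M"
    using sep[OF assms(1)] sep[OF assms(2)] by argo+
  show ?thesis
  proof (cases "{a, b} \<in> M")
    case True
    then have m: "{b, c} \<notin> M" "{c, d} \<in> M" "{d, a} \<notin> M" using alt by blast+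
    have "M' = M - {{a, b}, {c, d}} \<union> {{b, c}, {d, a}}"
      using * m True unfolding E by blast
    moreover have "{a, b} \<noteq> {c, d}" using abcd by (auto simp: doubleton_eq_iff)
    ultimately show ?thesis using that[of a b c d] True m by simp
  next
    case False
    then have m: "{b, c} \<in> M" "{c, d} \<notin> M" "{d, a} \<in> M" using alt by blast+
    have "M' = M - {{b, c}, {d, a}} \<union> {{c, d}, {a, b}}"
      using * m False unfolding E by blast
    moreover have "{b, c} \<noteq> {d, a}" using abcd by (auto simp: doubleton_eq_iff)
    ultimately show ?thesis using that[of b c d a] m by simp
  qed
qed

text \<open>
  The new edges each share a vertex with an old one, so no new edge is in \<open>M\<close> and no old one
  is in \<open>M'\<close>. The inclusions are hypotheses because in the application both matchings are given
  as unions with a common part.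
\<close>

lemma four_cycle_exchange:
  assumes "matching_on V M" "matching_on V M'"
    and "{a, b} \<in> M" "{c, d} \<in> M" "{a, b} \<noteq> {c, d}"
    and "{b, c} \<in> M'" "{d, a} \<in> M'"
    and "M - {{a, b}, {c, d}} \<subseteq> M'" "M' - {{b, c}, {d, a}} \<subseteq> M"
  shows "four_cycle (sym_diff M M')"
proof -
  have ab: "a \<noteq> b" "c \<noteq> d" using matching_on_distinct_ends assms by metis+
  have "a \<notin> {c, d}" "b \<notin> {c, d}"
    using matching_on_same_edge[OF assms(1,3,4)] assms(5) by blast+
  then have dist: "distinct [a, b, c, d]" using ab by auto
  have "{a, b} \<notin> M'" "{c, d} \<notin> M'"
    using matching_on_same_edge[OF assms(2,6)] dist by (auto simp: doubleton_eq_iff)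
  have "{b, c} \<notin> M" "{d, a} \<notin> M"
    using matching_on_same_edge[OF assms(1,3)] dist by (auto simp: doubleton_eq_iff)
  have diff: "A - B = X" if "X \<subseteq> A" "A - X \<subseteq> B" "X \<inter> B = {}" for A B X :: "'a set set"
    using that by blast
  have "M - M' = {{a, b}, {c, d}}"
    by (rule diff) (use assms(3,4,8) \<open>{a, b} \<notin> M'\<close> \<open>{c, d} \<notin> M'\<close> in simp_all)
  moreover have "M' - M = {{b, c}, {d, a}}"
    by (rule diff) (use assms(6,7,9) \<open>{b, c} \<notin> M\<close> \<open>{d, a} \<notin> M\<close> in simp_all)
  ultimately have "sym_diff M M' = {{a, b}, {c, d}} \<union> {{b, c}, {d, a}}" by simp
  then have "sym_diff M M' = {{a, b}, {b, c}, {c, d}, {d, a}}"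
    by auto
  then show ?thesis unfolding four_cycle_def using dist by blast
qed

lemma matching_on_exchange:
  assumes "matching_on V M" "{a, b} \<in> M" "{c, d} \<in> M" "{a, b} \<noteq> {c, d}"
  shows "matching_on V (M - {{a, b}, {c, d}} \<union> {{b, c}, {d, a}})"
proof -
  have ab: "a \<noteq> b" "c \<noteq> d" using matching_on_distinct_ends assms by metis+
  have "a \<notin> {c, d}" "b \<notin> {c, d}"
    using matching_on_same_edge[OF assms(1-3)] assms(4) by blast+
  then have dist: "distinct [a, b, c, d]" using ab by auto
  let ?W = "V - {a, b, c, d}"
  have V: "V = insert b (insert c (insert d (insert a ?W)))"
    using matching_on_Union[OF assms(1)] assms(2,3) by blast
  have touch: "e = {a, b} \<or> e = {c, d}" if "e \<in> M" "x \<in> e" "x \<in> {a, b, c, d}" for e x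
    using that(3) matching_on_same_edge[OF assms(1) that(1) assms(2) that(2)]
      matching_on_same_edge[OF assms(1) that(1) assms(3) that(2)] by auto
  have sub: "e \<subseteq> V" if "e \<in> M" for e
    using assms(1) that unfolding matching_on_def by blast
  have eq: "M - {{a, b}, {c, d}} = {e \<in> M. e \<subseteq> ?W}"
  proof (intro equalityI subsetI)
    fix e assume e: "e \<in> M - {{a, b}, {c, d}}"
    then have "x \<notin> {a, b, c, d}" if "x \<in> e" for x using touch[OF _ that] by blast
    then show "e \<in> {e \<in> M. e \<subseteq> ?W}" using e sub by blast
  next
    fix e assume "e \<in> {e \<in> M. e \<subseteq> ?W}"
    then show "e \<in> M - {{a, b}, {c, d}}" by auto
  qed
  have "matching_on ?W {e \<in> M. e \<subseteq> ?W}"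
  proof (rule matching_on_restrict[OF assms(1)])
    fix e assume e: "e \<in> M" "e \<inter> ?W \<noteq> {}"
    then have "e \<noteq> {a, b}" "e \<noteq> {c, d}" by auto
    then have "x \<notin> {a, b, c, d}" if "x \<in> e" for x using touch[OF e(1) that] by blast
    then show "e \<subseteq> ?W" using sub[OF e(1)] by blast
  qed blast
  then have "matching_on ?W (M - {{a, b}, {c, d}})" unfolding eq .
  then have "matching_on (insert d (insert a ?W)) (insert {d, a} (M - {{a, b}, {c, d}}))"
    by (rule matching_on_insert) (use dist in auto)
  then have "matching_on (insert b (insert c (insert d (insert a ?W))))
      (insert {b, c} (insert {d, a} (M - {{a, b}, {c, d}})))"
    by (rule matching_on_insert) (use dist in auto)
  then show ?thesis unfolding V[symmetric] by (simp add: insert_commute)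
qed

section \<open>Darts and cycles\<close>

text \<open>
  The other end of the edge of the identity matching at a vertex. As a dart, \<open>opp v\<close> is the same edge
  traversed in the opposite direction.
\<close>

definition opp :: "vertex \<Rightarrow> vertex" where
  "opp v = (fst v, \<not> snd v)"

lemma opp_simps [simp]: "opp (opp v) = v" "fst (opp v) = fst v" "opp v \<noteq> v" "v \<noteq> opp v" "fst \<circ> opp = fst"
  by (auto simp: opp_def prod_eq_iff)

lemma opp_eq_iff [simp]: "opp u = opp v \<longleftrightarrow> u = v"
  by (auto simp: opp_def prod_eq_iff)

lemma same_fst: "fst u = fst v \<Longrightarrow> u = v \<or> u = opp v"
  by (auto simp: opp_def prod_eq_iff)

lemma both_sides: "insert v (insert (opp v) X) = {fst v} \<times> UNIV \<union> X"
  by (cases v) (auto simp: opp_def)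

text \<open>
  Between two consecutive darts the walk leaves the first \<open>M\<^sub>0\<close>-edge at its far end \<open>opp x\<close> and enters
  the next one at \<open>y\<close>; these are the edges of the encoded matching along an open path.
\<close>

fun links :: "vertex list \<Rightarrow> vertex set set" where
  "links (x # y # xs) = insert {opp x, y} (links (y # xs))"
| "links _ = {}"

lemma links_append:
  assumes "xs \<noteq> []" "ys \<noteq> []"
  shows "links (xs @ ys) = insert {opp (last xs), hd ys} (links xs \<union> links ys)"
  using assms
proof (induction xs rule: links.induct)
  case (1 x y xs)
  then show ?case by auto
next
  case ("2_2" x)
  then show ?case by (cases ys) auto
qed simp

text \<open>
  The same path walked backwards, so that both the order and the directions of the darts are reversed.
\<close>

definition turned :: "vertex list \<Rightarrow> vertex list" where
  "turned xs = map opp (rev xs)"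

lemma turned_simps [simp]:
  "turned xs = [] \<longleftrightarrow> xs = []" "length (turned xs) = length xs"
  "image_mset fst (mset (turned xs)) = image_mset fst (mset xs)"
  by (auto simp: turned_def multiset.map_comp)

lemma hd_turned: "xs \<noteq> [] \<Longrightarrow> hd (turned xs) = opp (last xs)"
  by (simp add: turned_def hd_map hd_rev)

lemma last_turned: "xs \<noteq> [] \<Longrightarrow> last (turned xs) = opp (hd xs)"
  by (simp add: turned_def last_map last_rev)

lemma links_turned: "links (turned xs) = links xs"
proof (induction xs rule: links.induct)
  case (1 x y xs)
  have "turned (x # y # xs) = turned (y # xs) @ [opp x]" by (simp add: turned_def)
  then have "links (turned (x # y # xs)) = insert {opp (last (turned (y # xs))), opp x} (links (turned (y # xs)))"
    by (simp add: links_append)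
  then show ?case using 1 by (simp add: last_turned insert_commute)
qed (auto simp: turned_def)

lemma links_cut:
  assumes "e \<in> links L"
  obtains P Q where "P \<noteq> []" "Q \<noteq> []" "L = P @ Q" "e = {opp (last P), hd Q}"
  using assms
proof (induction L arbitrary: thesis rule: links.induct)
  case (1 x y xs)
  show ?case
  proof (cases "e = {opp x, y}")
    case True
    then show ?thesis using "1.prems"(1)[of "[x]" "y # xs"] by simp
  next
    case False
    then have "e \<in> links (y # xs)" using "1.prems"(2) by simp
    then obtain P Q where "P \<noteq> []" "Q \<noteq> []" "y # xs = P @ Q" "e = {opp (last P), hd Q}"
      using "1.IH" by metis
    then show ?thesis using "1.prems"(1)[of "x # P" Q] by simp
  qed
qed simp_all

lemma links_two_cuts:
  assumes "e \<in> links L" "f \<in> links L" "e \<noteq> f"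
  obtains P Q R where "P \<noteq> []" "Q \<noteq> []" "R \<noteq> []" "L = P @ Q @ R"
    "{e, f} = {{opp (last P), hd Q}, {opp (last Q), hd R}}"
proof -
  obtain A B where AB: "A \<noteq> []" "B \<noteq> []" "L = A @ B" "e = {opp (last A), hd B}"
    using links_cut[OF assms(1)] .
  have "f \<in> links A \<union> links B" using assms(2,3) AB by (auto simp: links_append)
  then consider "f \<in> links A" | "f \<in> links B" by blast
  then show ?thesis
  proof cases
    case 1
    then obtain P Q where "P \<noteq> []" "Q \<noteq> []" "A = P @ Q" "f = {opp (last P), hd Q}"
      using links_cut by metis
    then show ?thesis using AB that[of P Q B] by (simp add: insert_commute)
  next
    case 2
    then obtain Q R where "Q \<noteq> []" "R \<noteq> []" "B = Q @ R" "f = {opp (last Q), hd R}"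
      using links_cut by metis
    then show ?thesis using AB that[of A Q R] by simp
  qed
qed

text \<open>
  The ends \<open>opp d\<close> and \<open>e\<close> of the path are kept separate from the inner vertices, because \<open>e = d\<close> is
  allowed: this is the case in which the path closes up to a cycle.
\<close>

lemma matching_on_links:
  assumes "distinct (map fst (d # xs))" "fst e \<notin> fst ` set xs" "e \<noteq> opp d"
  shows "matching_on (insert (opp d) (insert e (fst ` set xs \<times> UNIV))) (links (d # xs @ [e]))"
  using assms
proof (induction xs arbitrary: d)
  case Nil
  then show ?case using matching_on_insert[OF matching_on_empty, of "opp d" e] by auto
next
  case (Cons x xs)
  let ?V = "insert (opp x) (insert e (fst ` set xs \<times> UNIV))"
  have "e \<noteq> opp x" using Cons.prems by auto
  then have "matching_on ?V (links (x # xs @ [e]))" using Cons by auto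
  then have "matching_on (insert (opp d) (insert x ?V)) (insert {opp d, x} (links (x # xs @ [e])))"
    by (rule matching_on_insert) (use Cons.prems in \<open>auto simp: mem_Times_iff dest: arg_cong[where f = fst]\<close>)
  moreover have "insert (opp d) (insert x ?V) =
      insert (opp d) (insert e (fst ` set (x # xs) \<times> UNIV))"
    using both_sides[of x "{}"] by auto
  ultimately show ?case by simp
qed

definition block_verts :: "vertex list \<Rightarrow> vertex set" where
  "block_verts b = fst ` set b \<times> UNIV"

definition cyc :: "vertex list \<Rightarrow> vertex set set" where
  "cyc b = links (b @ [hd b])"

lemma matching_on_cyc:
  assumes "b \<noteq> []" "distinct (map fst b)"
  shows "matching_on (block_verts b) (cyc b)"
proof -
  obtain d xs where b: "b = d # xs" using assms(1) by (cases b) auto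
  have "matching_on (insert (opp d) (insert d (fst ` set xs \<times> UNIV))) (links (d # xs @ [d]))"
    by (rule matching_on_links) (use assms(2) b in auto)
  moreover have "insert (opp d) (insert d (fst ` set xs \<times> UNIV)) = block_verts b"
    using both_sides[of d "{}"] by (auto simp: block_verts_def b)
  ultimately show ?thesis by (simp add: cyc_def b)
qed

text \<open>
  The matching has a single edge at each far end \<open>opp d\<close>, which forces the next dart of the walk; the
  walk stops when it reaches \<open>e\<close>.
\<close>

lemma links_determine_path:
  assumes "matching_on V M"
    and "links (d # xs @ [e]) \<subseteq> M" "links (d # ys @ [e]) \<subseteq> M" "e \<notin> set xs" "e \<notin> set ys"
  shows "xs = ys"
  using assms(2-)
proof (induction xs arbitrary: d ys)
  case Nil
  show ?case
  proof (cases ys)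
    case (Cons y ys')
    then have "e = y" using Nil matching_on_partner[OF assms(1), of "opp d" e y] by simp
    then show ?thesis using Nil Cons by simp
  qed simp
next
  case (Cons x xs)
  have "ys \<noteq> []"
  proof
    assume "ys = []"
    then have "e = x" using Cons.prems matching_on_partner[OF assms(1), of "opp d" e x] by simp
    then show False using Cons.prems by simp
  qed
  then obtain y ys' where ys: "ys = y # ys'" by (cases ys) auto
  have "x = y" using Cons.prems matching_on_partner[OF assms(1), of "opp d" x y] ys by simp
  then show ?case using Cons.IH[of x ys'] Cons.prems ys by simp
qed

lemma links_connect:
  assumes "links (d # xs @ [e]) \<subseteq> M"
    and "\<And>v. fst v \<in> fst ` set xs \<Longrightarrow> (v, opp v) \<in> A" "\<And>u v. {u, v} \<in> M \<Longrightarrow> (u, v) \<in> A"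
    and "v \<in> insert e (fst ` set xs \<times> UNIV)"
  shows "(opp d, v) \<in> A\<^sup>*"
  using assms
proof (induction xs arbitrary: d)
  case Nil
  then have "(opp d, e) \<in> A" "v = e" by auto
  then show ?case by blast
next
  case (Cons x xs)
  have 1: "(opp d, x) \<in> A" using Cons.prems by simp
  have "(x, opp x) \<in> A" using Cons.prems(2) by simp
  then have 2: "(opp d, opp x) \<in> A\<^sup>*" using 1 by (meson converse_rtrancl_into_rtrancl r_into_rtrancl)
  consider "v = x" | "v = opp x" | "v \<in> insert e (fst ` set xs \<times> UNIV)"
    using Cons.prems(4) same_fst[of v x] by (auto simp: image_iff)
  then show ?case
  proof cases
    case 3
    then have "(opp x, v) \<in> A\<^sup>*" using Cons by auto
    then show ?thesis using 2 by (rule rtrancl_trans[rotated])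
  qed (use 1 2 in auto)
qed

section \<open>Cycle systems\<close>

text \<open>
  The multiset equation says that every edge \<open>{i\<^sup>+, i\<^sup>-}\<close> of the identity matching is represented by exactly
  one dart. In this form it is visibly unaffected by permuting the cycles and by moving
  darts between cycles or turning them, which is all that flips do.
\<close>

definition cycle_system :: "nat \<Rightarrow> vertex list list \<Rightarrow> bool" where
  "cycle_system n css \<longleftrightarrow> [] \<notin> set css \<and> image_mset fst (mset (concat css)) = mset_set {..<n}"

definition matching_of :: "vertex list list \<Rightarrow> vertex set set" where
  "matching_of css = \<Union> (cyc ` set css)"

lemma cycle_system_mset_cong:
  assumes "mset css = mset css'"
  shows "cycle_system n css = cycle_system n css'" "matching_of css = matching_of css'"
proof -
  have "mset (concat css) = mset (concat css')"
    using assms by (simp add: mset_concat flip: sum_mset_sum_list)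
  moreover have "set css = set css'" using assms by (rule mset_eq_setD)
  ultimately show "cycle_system n css = cycle_system n css'" "matching_of css = matching_of css'"
    by (simp_all add: cycle_system_def matching_of_def)
qed

lemma cycle_system_props:
  assumes "cycle_system n css"
  shows "distinct css"
    and "b \<in> set css \<Longrightarrow> b \<noteq> []"
    and "b \<in> set css \<Longrightarrow> distinct (map fst b)"
    and "b \<in> set css \<Longrightarrow> b' \<in> set css \<Longrightarrow> b \<noteq> b' \<Longrightarrow> fst ` set b \<inter> fst ` set b' = {}"
    and "(\<Union>b\<in>set css. fst ` set b) = {..<n}"
proof -
  let ?L = "map (map fst) css"
  have ne: "[] \<notin> set css" and ms: "mset (concat ?L) = mset_set {..<n}"
    using assms by (simp_all add: cycle_system_def flip: map_concat)
  have "distinct (concat ?L)"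
    using ms mset_set_set[of "[0..<n]"] mset_eq_imp_distinct_iff[of "concat ?L" "[0..<n]"]
    by (simp add: atLeast0LessThan)
  moreover have "removeAll [] ?L = ?L" using ne by (induction css) auto
  ultimately have dl: "distinct ?L" and db: "\<And>ys. ys \<in> set ?L \<Longrightarrow> distinct ys"
    and dj: "\<And>ys zs. ys \<in> set ?L \<Longrightarrow> zs \<in> set ?L \<Longrightarrow> ys \<noteq> zs \<Longrightarrow> set ys \<inter> set zs = {}"
    unfolding distinct_concat_iff by auto
  show "distinct css" using dl distinct_map by blast
  show "b \<in> set css \<Longrightarrow> b \<noteq> []" using ne by blast
  show "b \<in> set css \<Longrightarrow> distinct (map fst b)" using db by auto
  show "b \<in> set css \<Longrightarrow> b' \<in> set css \<Longrightarrow> b \<noteq> b' \<Longrightarrow> fst ` set b \<inter> fst ` set b' = {}"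
    using dj[of "map fst b" "map fst b'"] dl by (auto simp: distinct_map dest: inj_onD)
  have "set (concat ?L) = {..<n}" using ms by (metis finite_lessThan finite_set_mset_mset_set set_mset_mset)
  then show "(\<Union>b\<in>set css. fst ` set b) = {..<n}" by simp
qed

lemma block_verts_disjoint:
  assumes "cycle_system n css" "b \<in> set css" "b' \<in> set css" "b \<noteq> b'"
  shows "block_verts b \<inter> block_verts b' = {}"
  using cycle_system_props(4)[OF assms] by (auto simp: block_verts_def)

lemma Union_block_verts:
  assumes "cycle_system n css"
  shows "(\<Union>b\<in>set css. block_verts b) = {..<n} \<times> UNIV"
  unfolding cycle_system_props(5)[OF assms, symmetric] by (auto simp: block_verts_def)

lemma matching_on_block:
  assumes "cycle_system n css" "b \<in> set css"
  shows "matching_on (block_verts b) (cyc b)"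
  using cycle_system_props(2,3)[OF assms] by (rule matching_on_cyc)

lemma matching_on_matching_of:
  assumes "cycle_system n css"
  shows "matching_on ({..<n} \<times> UNIV) (matching_of css)"
  unfolding matching_of_def Union_block_verts[OF assms, symmetric]
  by (rule matching_on_UN) (use assms matching_on_block block_verts_disjoint in auto)

lemma matching_of_block_closed:
  assumes "cycle_system n css" "b \<in> set css" "e \<in> matching_of css" "e \<inter> block_verts b \<noteq> {}"
  shows "e \<subseteq> block_verts b"
proof -
  obtain b' where b': "b' \<in> set css" "e \<in> cyc b'" using assms(3) by (auto simp: matching_of_def)
  then have "e \<subseteq> block_verts b'"
    using matching_on_Union[OF matching_on_block[OF assms(1) b'(1)]] by blast
  then have "b' = b" using block_verts_disjoint[OF assms(1) b'(1) assms(2)] assms(4) by blast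
  then show "e \<subseteq> block_verts b" using \<open>e \<subseteq> block_verts b'\<close> by simp
qed

lemma matching_on_identity: "matching_on ({..<n} \<times> UNIV) (identity_matching n)"
proof (induction n)
  case (Suc n)
  have "matching_on (insert (n, True) (insert (n, False) ({..<n} \<times> UNIV)))
      (insert {(n, True), (n, False)} (identity_matching n))"
    by (rule matching_on_insert[OF Suc]) auto
  moreover have "insert (n, True) (insert (n, False) ({..<n} \<times> UNIV)) = {..<Suc n} \<times> (UNIV :: bool set)"
    by (auto simp: less_Suc_eq UNIV_bool)
  moreover have "insert {(n, True), (n, False)} (identity_matching n) = identity_matching (Suc n)"
    unfolding identity_matching_def by (auto simp: less_Suc_eq)
  ultimately show ?case by simp
qed (simp add: identity_matching_def matching_on_empty)

lemma identity_matching_iff: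
  "{u, v} \<in> identity_matching n \<longleftrightarrow> v = opp u \<and> fst u < n"
proof
  assume "{u, v} \<in> identity_matching n"
  then obtain i where "i < n" "{u, v} = {(i, True), (i, False)}" by (auto simp: identity_matching_def)
  then show "v = opp u \<and> fst u < n" by (auto simp: doubleton_eq_iff opp_def)
next
  assume "v = opp u \<and> fst u < n"
  then show "{u, v} \<in> identity_matching n"
    unfolding identity_matching_def
    by (cases u) (auto simp: opp_def insert_commute intro!: exI[of _ "fst u"])
qed

lemma identity_matching_block_closed:
  assumes "e \<in> identity_matching n" "e \<inter> block_verts b \<noteq> {}"
  shows "e \<subseteq> block_verts b"
  using assms by (auto simp: identity_matching_def block_verts_def)

text \<open>
  The edge of the identity matching leads from the first dart to its far end, and the walk from there visits
  all other vertices of the cycle.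
\<close>

lemma block_connected:
  assumes "cycle_system n css" "b \<in> set css" "v \<in> block_verts b"
  shows "(hd b, v) \<in> (parcs (union_graph n (matching_of css)))\<^sup>*"
proof -
  let ?A = "parcs (union_graph n (matching_of css))"
  obtain d xs where b: "b = d # xs" using cycle_system_props(2)[OF assms(1,2)] by (cases b) auto
  have mate: "(u, opp u) \<in> ?A" if "fst u \<in> fst ` set b" for u
    using that cycle_system_props(5)[OF assms(1)] assms(2)
    by (auto simp: union_graph_def identity_matching_iff)
  have "links (d # xs @ [d]) \<subseteq> matching_of css"
    using assms(2) by (auto simp: matching_of_def cyc_def b)
  then have conn: "(opp d, v) \<in> ?A\<^sup>*" if "v \<in> insert d (fst ` set xs \<times> UNIV)" for v
    by (rule links_connect) (use that mate b in \<open>auto simp: union_graph_def\<close>)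
  have step: "(d, opp d) \<in> ?A" using mate[of d] b by simp
  have "v = opp d \<or> v \<in> insert d (fst ` set xs \<times> UNIV)"
    using assms(3) both_sides[of d "{}"] by (auto simp: block_verts_def b)
  then show ?thesis using step conn by (auto simp: b intro: converse_rtrancl_into_rtrancl)
qed

text \<open>
  The vertex sets of the encoded cycles partition the vertices; each is connected by its own walk, and
  no edge leaves it.
\<close>

lemma sccs_verts_union_graph:
  assumes "cycle_system n css"
  shows "pre_digraph.sccs_verts (with_proj (union_graph n (matching_of css))) = block_verts ` set css"
proof -
  let ?M = "matching_of css" and ?U = "union_graph n (matching_of css)"
  have "perfect_matching (complete_graph_2n n) ?M"
    using matching_on_matching_of[OF assms] by (simp add: perfect_matching_complete_graph_2n)
  then interpret U: pair_graph ?U by (rule pair_graph_union_graph)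
  have sub: "block_verts b \<subseteq> pverts ?U" if "b \<in> set css" for b
    using Union_block_verts[OF assms] that by (auto simp: union_graph_def)
  have reach: "u \<rightarrow>\<^sup>*\<^bsub>with_proj ?U\<^esub> v" if "b \<in> set css" "u \<in> block_verts b" "v \<in> block_verts b" for b u v
  proof -
    have "hd b \<in> block_verts b"
      using cycle_system_props(2)[OF assms that(1)] by (cases b) (auto simp: block_verts_def mem_Times_iff)
    then have conn: "hd b \<rightarrow>\<^sup>*\<^bsub>with_proj ?U\<^esub> w" if "w \<in> block_verts b" for w
      using block_connected[OF assms \<open>b \<in> set css\<close> that] sub[OF \<open>b \<in> set css\<close>] that
      by (auto simp: U.reachable_conv)
    show ?thesis
      by (rule U.reachable_trans[OF U.symmetric_reachable'[OF conn[OF that(2)]] conn[OF that(3)]])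
  qed
  have closed: "v \<in> block_verts b" if "u \<rightarrow>\<^sup>*\<^bsub>with_proj ?U\<^esub> v" "b \<in> set css" "u \<in> block_verts b" for b u v
    using that(1,3)
  proof (induction rule: U.converse_reachable_induct)
    case (step x y)
    then have "{x, y} \<in> identity_matching n \<or> {x, y} \<in> ?M" by (auto simp: union_graph_def)
    moreover have "{x, y} \<inter> block_verts b \<noteq> {}" using step.prems by simp
    ultimately have "{x, y} \<subseteq> block_verts b"
      using identity_matching_block_closed[of "{x, y}" n b] matching_of_block_closed[OF assms that(2), of "{x, y}"]
      by argo
    then show ?case using step.IH by simp
  qed
  have scc: "block_verts b \<in> U.sccs_verts" if b: "b \<in> set css" for b
    unfolding U.in_sccs_verts_conv_reachable
  proof (intro conjI ballI allI impI)
    show "block_verts b \<noteq> {}"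
      using cycle_system_props(2)[OF assms b] by (simp add: block_verts_def)
    show "\<not> u \<rightarrow>\<^sup>*\<^bsub>with_proj ?U\<^esub> v \<or> \<not> v \<rightarrow>\<^sup>*\<^bsub>with_proj ?U\<^esub> u"
      if "u \<in> block_verts b" "v \<notin> block_verts b" for u v
      using closed[OF _ b that(1)] that(2) by metis
  qed (rule reach[OF b])
  show ?thesis
  proof (intro equalityI subsetI)
    fix S assume S: "S \<in> U.sccs_verts"
    then obtain u where u: "u \<in> S" by (auto simp: U.in_sccs_verts_conv_reachable)
    then have "u \<in> {..<n} \<times> UNIV" using U.sccs_verts_subsets[OF S] by (auto simp: union_graph_def)
    then obtain b where b: "b \<in> set css" "u \<in> block_verts b" using Union_block_verts[OF assms] by blast
    then have "S = block_verts b" using U.sccs_verts_disjoint[OF S scc[OF b(1)]] u by blast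
    then show "S \<in> block_verts ` set css" using b by blast
  qed (use scc in auto)
qed

lemma inj_on_block_verts:
  assumes "cycle_system n css"
  shows "inj_on block_verts (set css)"
proof (rule inj_onI, rule ccontr)
  fix b b' assume *: "b \<in> set css" "b' \<in> set css" "block_verts b = block_verts b'" "b \<noteq> b'"
  then have "block_verts b = {}" using block_verts_disjoint[OF assms *(1,2,4)] by simp
  then show False using cycle_system_props(2)[OF assms *(1)] by (simp add: block_verts_def)
qed

text \<open>
  Both matchings restrict to perfect matchings of the \<open>2 * length b\<close> vertices of the cycle, so each contributes
  \<open>length b\<close> edges. This counts a common edge twice, as for a cycle of length 2.
\<close>

lemma cycle_length_block:
  assumes "cycle_system n css" "b \<in> set css"
  shows "cycle_length n (matching_of css) (block_verts b) = 2 * length b"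
proof -
  let ?S = "block_verts b" and ?M = "matching_of css" and ?V = "{..<n} \<times> (UNIV :: bool set)"
  have finS: "finite ?S" by (simp add: block_verts_def)
  have subS: "?S \<subseteq> ?V" using Union_block_verts[OF assms(1)] assms(2) by blast
  have cardS: "card ?S = 2 * length b"
    using cycle_system_props(3)[OF assms]
    by (simp add: block_verts_def card_cartesian_product distinct_card[of "map fst b", simplified])
  have count: "size {#e \<in># mset_set N. e \<subseteq> ?S#} = length b"
    if N: "matching_on ?V N" and cl: "\<And>e. e \<in> N \<Longrightarrow> e \<inter> ?S \<noteq> {} \<Longrightarrow> e \<subseteq> ?S" for N
  proof -
    have "matching_on ?S {e \<in> N. e \<subseteq> ?S}" by (rule matching_on_restrict[OF N subS cl])
    then have "2 * card {e \<in> N. e \<subseteq> ?S} = 2 * length b"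
      using card_matching_on(2)[OF _ finS] cardS by simp
    moreover have "finite N" using card_matching_on(1)[OF N] by simp
    ultimately show ?thesis by (simp add: filter_mset_mset_set)
  qed
  have "size {#e \<in># mset_set (identity_matching n). e \<subseteq> ?S#} = length b"
    by (rule count[OF matching_on_identity identity_matching_block_closed])
  moreover have "size {#e \<in># mset_set ?M. e \<subseteq> ?S#} = length b"
    by (rule count[OF matching_on_matching_of[OF assms(1)] matching_of_block_closed[OF assms]])
  ultimately show ?thesis by (simp add: cycle_length_def)
qed

lemma matching_type_matching_of:
  assumes "cycle_system n css"
  shows "matching_type n (matching_of css) = rev (sort (map length css))"
proof -
  have "mset_set (block_verts ` set css) = mset (map block_verts css)"
    using inj_on_block_verts[OF assms] cycle_system_props(1)[OF assms]
    by (simp add: mset_set_set flip: image_mset_mset_set)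
  then have "{#cycle_length n (matching_of css) S div 2. S \<in># mset_set (block_verts ` set css)#} =
      image_mset (\<lambda>b. cycle_length n (matching_of css) (block_verts b) div 2) (mset css)"
    by (simp add: multiset.map_comp o_def)
  also have "\<dots> = image_mset length (mset css)"
    by (rule image_mset_cong) (use cycle_length_block[OF assms] in simp)
  finally show ?thesis
    unfolding matching_type_def sccs_verts_union_graph[OF assms]
    by (simp flip: mset_map)
qed

section \<open>Flips of cycle systems\<close>

lemma links_overlap: "links (xs @ x # ys) = links (xs @ [x]) \<union> links (x # ys)"
proof (induction xs)
  case (Cons z zs)
  then show ?case by (cases zs) auto
qed simp

lemma matching_of_Cons [simp]: "matching_of (b # bs) = cyc b \<union> matching_of bs"
  by (simp add: matching_of_def)

text \<open>
  A cycle cut at two places. The starting dart \<open>d\<close> is repeated at the end of the last piece, so that the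
  arc through \<open>d\<close> appears as the two paths \<open>P\<close> and \<open>R\<close>, and \<open>Q\<close> is the arc that avoids it.
\<close>

lemma cyc_three_arcs:
  assumes "P = d # xs" "Q \<noteq> []" "R = zs @ [d]"
  shows "cyc (P @ Q @ zs) =
    {{opp (last P), hd Q}, {opp (last Q), hd R}} \<union> (links P \<union> links Q \<union> links R)"
proof -
  have "cyc (P @ Q @ zs) = links (P @ Q @ R)" using assms by (simp add: cyc_def)
  moreover have "P \<noteq> []" "R \<noteq> []" using assms by simp_all
  ultimately show ?thesis using assms(2) by (simp add: links_append Un_assoc)
qed

lemma cyc_self: "b \<noteq> [] \<Longrightarrow> cyc b = insert {opp (last b), hd b} (links b)"
  by (simp add: cyc_def links_append)

lemma repairing_cases:
  assumes "{{a, b}, {c, d}} = {{p, q}, {r, s}}" "{a, b} \<noteq> {c, d}"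
  shows "{{b, c}, {d, a}} = {{p, r}, {q, s}} \<or> {{b, c}, {d, a}} = {{p, s}, {q, r}}"
proof -
  have "{a, b} = {p, q} \<and> {c, d} = {r, s} \<or> {a, b} = {r, s} \<and> {c, d} = {p, q}"
    using assms(1) by (simp only: doubleton_eq_iff[of "{a, b}" "{c, d}" "{p, q}" "{r, s}"])
  then show ?thesis
    unfolding doubleton_eq_iff by (elim disjE conjE) (simp_all add: insert_commute)
qed

text \<open>
  If both edges lie on one cycle, cut it at them into the arc \<open>Q\<close> that avoids the starting dart and the rest.
  Joining the ends of the rest to each other splits off \<open>Q\<close> as a cycle; the other new pairing puts \<open>Q\<close>
  back backwards. If the edges lie on two cycles, the second cycle is cut open and
  inserted into the first one at the cut, forwards or backwards according to the pairing. In every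
  case the flipped matching is contained in the one encoded by the new system, hence equal to it.
\<close>

lemma flip_of_cycle_system:
  assumes sys: "cycle_system n css"
    and edges: "{a, b} \<in> matching_of css" "{c, d} \<in> matching_of css" "{a, b} \<noteq> {c, d}"
    and M': "matching_on ({..<n} \<times> UNIV) M'" "M' \<subseteq> matching_of css - {{a, b}, {c, d}} \<union> {{b, c}, {d, a}}"
  obtains (recount) css' where "cycle_system n css'" "matching_of css' = M'" "length css' \<noteq> length css"
  | (reversal) i x xs ys zs where "i < length css" "css ! i = x # xs @ ys @ zs" "ys \<noteq> []"
      "cycle_system n (css[i := x # xs @ turned ys @ zs])"
      "matching_of (css[i := x # xs @ turned ys @ zs]) = M'"
proof -
  have exchanged: "matching_of css' = M'"
    if "cycle_system n css'" "matching_of css = E \<union> N" "matching_of css' = E' \<union> N"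
      "E = {{a, b}, {c, d}}" "E' = {{b, c}, {d, a}}" for css' E E' N
  proof -
    have "M' \<subseteq> matching_of css - E \<union> E'" using M'(2) that(4,5) by simp
    then have "M' \<subseteq> matching_of css'" using that(2,3) by blast
    then show ?thesis using matching_on_subset_eq[OF M'(1) matching_on_matching_of[OF that(1)]] by simp
  qed
  obtain b1 b2 where b1: "b1 \<in> set css" "{a, b} \<in> cyc b1" and b2: "b2 \<in> set css" "{c, d} \<in> cyc b2"
    using edges by (auto simp: matching_of_def)
  note ne = cycle_system_props(2)[OF sys]
  show ?thesis
  proof (cases "b1 = b2")
    case True
    obtain x ds where bx: "b1 = x # ds" using ne[OF b1(1)] by (cases b1) auto
    have in_links: "{a, b} \<in> links (x # ds @ [x])" "{c, d} \<in> links (x # ds @ [x])"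
      using b1(2) b2(2) unfolding True[symmetric] bx cyc_def by simp_all
    obtain P Q R where PQR: "P \<noteq> []" "Q \<noteq> []" "R \<noteq> []" "x # ds @ [x] = P @ Q @ R"
      and cut: "{{a, b}, {c, d}} = {{opp (last P), hd Q}, {opp (last Q), hd R}}"
      using links_two_cuts[OF in_links edges(3)] .
    obtain xs where P: "P = x # xs" using PQR by (cases P) auto
    have "last (P @ Q @ R) = x" using PQR(4) by (metis last_snoc append_Cons)
    then obtain zs where R: "R = zs @ [x]" using PQR(3) by (cases R rule: rev_cases) auto
    have ds: "ds = xs @ Q @ zs" using PQR(4) P R by simp
    define rest where "rest = remove1 b1 css"
    have ms: "mset css = mset (b1 # rest)" using b1(1) by (simp add: rest_def)
    obtain i where i: "i < length css" "css ! i = b1" using b1(1) by (metis in_set_conv_nth)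
    let ?N = "links P \<union> links Q \<union> links R \<union> matching_of rest"
    have M: "matching_of css = {{opp (last P), hd Q}, {opp (last Q), hd R}} \<union> ?N"
      unfolding cycle_system_mset_cong(2)[OF ms] using cyc_three_arcs[OF P PQR(2) R]
      by (simp add: bx ds P Un_assoc)
    consider "{{b, c}, {d, a}} = {{opp (last P), opp (last Q)}, {hd Q, hd R}}"
      | "{{b, c}, {d, a}} = {{opp (last P), hd R}, {hd Q, opp (last Q)}}"
      using repairing_cases[OF cut edges(3)] by (elim disjE)
    then show ?thesis
    proof cases
      case 1
      let ?b = "x # xs @ turned Q @ zs"
      have ms': "mset (css[i := ?b]) = mset (?b # rest)"
        using i ms by (simp add: mset_update)
      have "cycle_system n (?b # rest)"
        using sys unfolding cycle_system_mset_cong(1)[OF ms]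
        by (auto simp: cycle_system_def bx ds)
      then have s': "cycle_system n (css[i := ?b])" using cycle_system_mset_cong(1)[OF ms'] by simp
      have "matching_of (css[i := ?b]) = {{opp (last P), opp (last Q)}, {hd Q, hd R}} \<union> ?N"
        unfolding cycle_system_mset_cong(2)[OF ms'] using cyc_three_arcs[OF P _ R, of "turned Q"] PQR(2)
        by (simp add: P hd_turned last_turned links_turned Un_assoc)
      then have "matching_of (css[i := ?b]) = M'" using exchanged[OF s' M] cut 1 by simp
      then show ?thesis using reversal[of i x xs Q zs] i bx ds PQR(2) s' by simp
    next
      case 2
      let ?css = "(x # xs @ zs) # Q # rest"
      have s': "cycle_system n ?css"
        using sys PQR(2) unfolding cycle_system_mset_cong(1)[OF ms]
        by (auto simp: cycle_system_def bx ds union_ac)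
      have "cyc (x # xs @ zs) = insert {opp (last P), hd R} (links P \<union> links R)"
        using links_append[OF PQR(1,3)] by (simp add: cyc_def P R)
      moreover have "cyc Q = insert {hd Q, opp (last Q)} (links Q)"
        using cyc_self[OF PQR(2)] by (simp add: insert_commute)
      ultimately have "matching_of ?css = {{opp (last P), hd R}, {hd Q, opp (last Q)}} \<union> ?N"
        by (simp add: Un_ac insert_commute)
      then have "matching_of ?css = M'" using exchanged[OF s' M] cut 2 by simp
      moreover have "length css = length (b1 # rest)" using ms by (rule mset_eq_length)
      ultimately show ?thesis using recount[OF s'] by simp
    qed
  next
    case False
    define rest where "rest = remove1 b2 (remove1 b1 css)"
    have split_off: "mset l = mset (y # remove1 y l)" if "y \<in> set l" for y and l :: "vertex list list"
      using that by simp
    have "b2 \<in> set (remove1 b1 css)" using b2(1) False by simp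
    then have "mset (remove1 b1 css) = mset (b2 # rest)" unfolding rest_def by (rule split_off)
    moreover have "mset css = mset (b1 # remove1 b1 css)" using b1(1) by (rule split_off)
    ultimately have ms: "mset css = mset (b1 # b2 # rest)" by (simp only: mset.simps)
    obtain x ds where bx: "b1 = x # ds" using ne[OF b1(1)] by (cases b1) auto
    obtain e es where be: "b2 = e # es" using ne[OF b2(1)] by (cases b2) auto
    obtain P Q where PQ: "P \<noteq> []" "Q \<noteq> []" "x # ds @ [x] = P @ Q" "{a, b} = {opp (last P), hd Q}"
      using links_cut[of "{a, b}" "x # ds @ [x]"] b1(2) unfolding bx cyc_def append_Cons list.sel .
    obtain P2 Q2 where PQ2: "P2 \<noteq> []" "Q2 \<noteq> []" "e # es @ [e] = P2 @ Q2" "{c, d} = {opp (last P2), hd Q2}"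
      using links_cut[of "{c, d}" "e # es @ [e]"] b2(2) unfolding be cyc_def append_Cons list.sel .
    obtain xs where P: "P = x # xs" using PQ by (cases P) auto
    have "last (P @ Q) = x" using PQ(3) by (metis last_snoc append_Cons)
    then obtain ys where Q: "Q = ys @ [x]" using PQ(2) by (cases Q rule: rev_cases) auto
    obtain us where P2: "P2 = e # us" using PQ2 by (cases P2) auto
    have "last (P2 @ Q2) = e" using PQ2(3) by (metis last_snoc append_Cons)
    then obtain vs where Q2: "Q2 = vs @ [e]" using PQ2(2) by (cases Q2 rule: rev_cases) auto
    have ds: "ds = xs @ ys" and es: "es = us @ vs" using PQ(3) P Q PQ2(3) P2 Q2 by simp_all
    \<comment> \<open>The second cycle, rotated so that its removed edge is the closing one.\<close>
    define W where "W = vs @ e # us"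
    have W: "W \<noteq> []" "hd W = hd Q2" "last W = last P2"
      by (simp_all add: W_def P2 Q2 hd_append)
    have lW: "links W = links P2 \<union> links Q2"
      using links_overlap[of vs e us] by (simp add: W_def P2 Q2 Un_commute)
    let ?N = "links P \<union> links Q \<union> links W \<union> matching_of rest"
    have "cyc b1 = insert {opp (last P), hd Q} (links P \<union> links Q)"
      using links_append[OF PQ(1,2)] PQ(3) by (simp add: cyc_def bx)
    moreover have "cyc b2 = insert {opp (last W), hd W} (links W)"
      using links_append[OF PQ2(1,2)] PQ2(3) by (simp add: cyc_def be W lW)
    ultimately have M: "matching_of css = {{opp (last P), hd Q}, {opp (last W), hd W}} \<union> ?N"
      unfolding cycle_system_mset_cong(2)[OF ms] by (simp add: Un_ac insert_commute)
    have cut: "{{a, b}, {c, d}} = {{opp (last P), hd Q}, {opp (last W), hd W}}"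
      using PQ(4) PQ2(4) W by simp
    \<comment> \<open>\<open>W\<close> is the second cycle opened at its removed edge; it is inserted into the first cycle in one of its two directions.\<close>
    have merged: ?thesis
      if "W' = W \<or> W' = turned W" "{{b, c}, {d, a}} = {{opp (last P), hd W'}, {opp (last W'), hd Q}}" for W'
    proof -
      let ?css = "(x # xs @ W' @ ys) # rest"
      have W': "W' \<noteq> []" "links W' = links W" "image_mset fst (mset W') = image_mset fst (mset W)"
        using that(1) W(1) by (elim disjE; simp add: links_turned)+
      have s': "cycle_system n ?css"
        using sys W'(3) unfolding cycle_system_mset_cong(1)[OF ms]
        by (auto simp: cycle_system_def bx ds be es W_def union_ac)
      have "matching_of ?css = {{opp (last P), hd W'}, {opp (last W'), hd Q}} \<union> ?N"
        using cyc_three_arcs[OF P W'(1) Q] W'(2) by (simp add: P Un_assoc Un_left_commute)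
      then have "matching_of ?css = M'" using exchanged[OF s' M] cut that(2) by simp
      moreover have "length css = length (b1 # b2 # rest)" using ms by (rule mset_eq_length)
      ultimately show ?thesis using recount[OF s'] by simp
    qed
    consider "{{b, c}, {d, a}} = {{opp (last P), opp (last W)}, {hd Q, hd W}}"
      | "{{b, c}, {d, a}} = {{opp (last P), hd W}, {hd Q, opp (last W)}}"
      using repairing_cases[OF cut edges(3)] by (elim disjE)
    then show ?thesis
    proof cases
      case 1
      then show ?thesis using merged[of "turned W"] W(1) by (simp add: hd_turned last_turned insert_commute)
    next
      case 2
      then show ?thesis using merged[of W] by (simp add: insert_commute)
    qed
  qed
qed

text \<open>
  Induction on the number of edges of the identity matching that are missing from \<open>M\<close>. A flip inserts
  a missing edge \<open>{p, opp p}\<close> and removes the edges of \<open>M\<close> at \<open>p\<close> and \<open>opp p\<close>, neither of which is in the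
  identity matching. The result is encoded by induction, and flipping back encodes \<open>M\<close>.
\<close>

lemma cycle_system_of_matching:
  assumes "matching_on ({..<n} \<times> UNIV) M"
  obtains css where "cycle_system n css" "matching_of css = M"
proof -
  have fin: "finite (identity_matching n)"
    using card_matching_on(1)[OF matching_on_identity] by simp
  have "\<exists>css. cycle_system n css \<and> matching_of css = M"
    using assms
  proof (induction "card (identity_matching n - M)" arbitrary: M rule: less_induct)
    case less
    show ?case
    proof (cases "identity_matching n \<subseteq> M")
      case True
      then have "M = identity_matching n"
        using matching_on_subset_eq[OF matching_on_identity less.prems] by simp
      moreover have "cycle_system n (map (\<lambda>i. [(i, False)]) [0..<n])"
        by (simp add: cycle_system_def o_def atLeast0LessThan image_iff flip: mset_map)
      moreover have "matching_of (map (\<lambda>i. [(i, False)]) [0..<n]) = identity_matching n"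
        by (auto simp: matching_of_def cyc_def opp_def identity_matching_def)
      ultimately show ?thesis by blast
    next
      case False
      then obtain e where e: "e \<in> identity_matching n" "e \<notin> M" by blast
      then obtain i where i: "i < n" "e = {(i, True), (i, False)}" by (auto simp: identity_matching_def)
      define p where "p = (i, True)"
      have p: "e = {p, opp p}" "p \<in> {..<n} \<times> UNIV" "opp p \<in> {..<n} \<times> UNIV"
        using i by (auto simp: p_def opp_def)
      obtain u where u: "{p, u} \<in> M" using matching_on_covered[OF less.prems p(2)] by metis
      obtain v where v: "{opp p, v} \<in> M" using matching_on_covered[OF less.prems p(3)] by metis
      have uv: "u \<noteq> opp p" "v \<noteq> p" using u v e(2) p(1) by (auto simp: insert_commute)
      have up: "u \<noteq> p" using matching_on_distinct_ends[OF less.prems u] by simp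
      have ne: "{u, p} \<noteq> {opp p, v}" using uv by (auto simp: doubleton_eq_iff)
      have uM: "{u, p} \<in> M" using u by (simp add: insert_commute)
      define M' where "M' = M - {{u, p}, {opp p, v}} \<union> {{p, opp p}, {v, u}}"
      have M': "matching_on ({..<n} \<times> UNIV) M'"
        unfolding M'_def by (rule matching_on_exchange[OF less.prems uM v ne])
      have "{u, p} \<notin> identity_matching n" "{opp p, v} \<notin> identity_matching n"
        using uv by (auto simp: identity_matching_iff insert_commute[of u p])
      then have "identity_matching n - M' \<subset> identity_matching n - M"
        using e p(1) unfolding M'_def by blast
      then have "card (identity_matching n - M') < card (identity_matching n - M)"
        using fin by (simp add: psubset_card_mono)
      then obtain css where css: "cycle_system n css" "matching_of css = M'"
        using less.hyps[OF _ M'] by blast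
      have new: "{p, opp p} \<in> matching_of css" "{v, u} \<in> matching_of css" "{p, opp p} \<noteq> {v, u}"
        using uv up by (auto simp: css(2) M'_def doubleton_eq_iff)
      have "{e1, e2} \<subseteq> A \<Longrightarrow> f1 \<notin> A \<Longrightarrow> f2 \<notin> A \<Longrightarrow> A \<subseteq> (A - {e1, e2} \<union> {f1, f2}) - {f1, f2} \<union> {e2, e1}"
        for e1 e2 f1 f2 :: "vertex set" and A by blast
      moreover have "{p, opp p} \<notin> M" using e p by simp
      moreover have "{v, u} \<notin> M"
      proof
        assume "{v, u} \<in> M"
        then have "v = p" using matching_on_partner[OF less.prems, of u v p] uM by (simp add: insert_commute)
        then show False using uv by simp
      qed
      ultimately have "M \<subseteq> matching_of css - {{p, opp p}, {v, u}} \<union> {{opp p, v}, {u, p}}"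
        using uM v by (simp add: css(2) M'_def)
      then show ?thesis
        by (rule flip_of_cycle_system[OF css(1) new less.prems]) auto
    qed
  qed
  then show ?thesis using that by blast
qed

text \<open>
  The orders of the cycles, their starting points and their directions are the only freedom in
  encoding a matching, and the list of first darts fixes all three.
\<close>

lemma cycle_system_determined:
  assumes "cycle_system n css" "cycle_system n css'"
    and "matching_of css = matching_of css'" "map hd css = map hd css'"
  shows "css = css'"
proof (rule nth_equalityI)
  show len: "length css = length css'" using assms(4) by (rule map_eq_imp_length_eq)
  fix i assume i: "i < length css"
  obtain x xs where b: "css ! i = x # xs"
    using cycle_system_props(2)[OF assms(1) nth_mem] i len by (cases "css ! i") auto
  obtain y ys where b': "css' ! i = y # ys"
    using cycle_system_props(2)[OF assms(2) nth_mem] i len by (cases "css' ! i") auto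
  have xy: "y = x" using arg_cong[OF assms(4), of "\<lambda>l. l ! i"] i len b b' by simp
  have "cyc (css ! i) \<subseteq> matching_of css" using nth_mem[OF i] by (auto simp: matching_of_def)
  moreover have "cyc (css' ! i) \<subseteq> matching_of css"
    unfolding assms(3) using nth_mem[OF i[unfolded len]] by (auto simp: matching_of_def)
  ultimately have "links (x # xs @ [x]) \<subseteq> matching_of css" "links (x # ys @ [x]) \<subseteq> matching_of css"
    by (simp_all add: cyc_def b b' xy)
  moreover have "distinct (map fst (x # xs))" "distinct (map fst (x # ys))"
    using cycle_system_props(3)[OF assms(1) nth_mem] cycle_system_props(3)[OF assms(2) nth_mem]
      i len b b' xy by metis+
  then have "x \<notin> set xs" "x \<notin> set ys" by auto
  ultimately have "xs = ys"
    using links_determine_path[OF matching_on_matching_of[OF assms(1)]] by blast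
  then show "css ! i = css' ! i" using b b' xy by simp
qed

section \<open>Signed reversals and Cartesian products\<close>

lemma signed_perms_iff: "\<sigma> \<in> signed_perms k \<longleftrightarrow> mset (map abs \<sigma>) = mset [1..int k]"
proof
  assume "\<sigma> \<in> signed_perms k"
  then have "set (map abs \<sigma>) = set [1..int k]" "distinct (map abs \<sigma>)"
    by (auto simp: signed_perms_def permutations_of_set_def)
  then show "mset (map abs \<sigma>) = mset [1..int k]" 
    using set_eq_iff_mset_eq_distinct[of "map abs \<sigma>" "[1..int k]"] by simp
next
  assume *: "mset (map abs \<sigma>) = mset [1..int k]"
  have "set (map abs \<sigma>) = set [1..int k]" using mset_eq_setD[OF *] .
  moreover have "distinct (map abs \<sigma>)" using mset_eq_imp_distinct_iff[OF *] by simp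
  ultimately show "\<sigma> \<in> signed_perms k" by (simp add: signed_perms_def permutations_of_set_def)
qed

lemma signed_perms_entries:
  assumes "\<sigma> \<in> signed_perms k" "x \<in> set \<sigma>"
  shows "x \<noteq> 0" "nat \<bar>x\<bar> \<le> k"
proof -
  have "\<bar>x\<bar> \<in> {1..int k}"
    using assms by (auto simp: signed_perms_def permutations_of_set_def)
  then show "x \<noteq> 0" "nat \<bar>x\<bar> \<le> k" by auto
qed

text \<open>
  The signed reversal without its two positions, which makes it compatible with maps on the entries.
\<close>

definition reversal_step :: "int list \<Rightarrow> int list \<Rightarrow> bool" where
  "reversal_step \<sigma> \<tau> \<longleftrightarrow>
     (\<exists>xs ys zs. ys \<noteq> [] \<and> \<sigma> = xs @ ys @ zs \<and> \<tau> = xs @ map uminus (rev ys) @ zs)"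

lemma reversal_step_signed_perms:
  assumes "reversal_step \<sigma> \<tau>" "\<sigma> \<in> signed_perms k"
  shows "\<tau> \<in> signed_perms k"
  using assms by (auto simp: reversal_step_def signed_perms_iff multiset.map_comp o_def)

lemma arc_SR_iff: "(\<sigma>, \<tau>) \<in> parcs (SR k) \<longleftrightarrow> \<sigma> \<in> signed_perms k \<and> reversal_step \<sigma> \<tau>"
proof
  assume "(\<sigma>, \<tau>) \<in> parcs (SR k)"
  then obtain i j where \<sigma>: "\<sigma> \<in> signed_perms k" and ij: "1 \<le> i" "i \<le> j" "j \<le> length \<sigma>"
    and \<tau>: "\<tau> = signed_reversal i j \<sigma>"
    by (auto simp: SR_def length_signed_perms)
  obtain xs ys zs where *: "\<sigma> = xs @ ys @ zs" "length ys = j - (i - 1)"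
    "\<tau> = xs @ map uminus (rev ys) @ zs"
    using signed_reversal_split[OF ij] \<tau> by metis
  then have "ys \<noteq> []" using ij by auto
  then show "\<sigma> \<in> signed_perms k \<and> reversal_step \<sigma> \<tau>"
    using \<sigma> * unfolding reversal_step_def by blast
next
  assume *: "\<sigma> \<in> signed_perms k \<and> reversal_step \<sigma> \<tau>"
  then obtain xs ys zs where y: "ys \<noteq> []" "\<sigma> = xs @ ys @ zs" "\<tau> = xs @ map uminus (rev ys) @ zs"
    unfolding reversal_step_def by blast
  let ?i = "length xs + 1" and ?j = "length xs + length ys"
  have "\<tau> = signed_reversal ?i ?j \<sigma>" using y by (simp add: signed_reversal_def)
  moreover have "1 \<le> ?i" "?i \<le> ?j" using y(1) by (auto simp: Suc_le_eq)
  moreover have "?j \<le> k" using y(2) length_signed_perms[of \<sigma> k] * by simp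
  ultimately have "\<exists>i j. 1 \<le> i \<and> i \<le> j \<and> j \<le> k \<and> \<tau> = signed_reversal i j \<sigma>" by blast
  then show "(\<sigma>, \<tau>) \<in> parcs (SR k)"
    using * reversal_step_signed_perms[of \<sigma> \<tau> k] by (simp add: SR_def)
qed

lemma reversal_step_Cons:
  assumes "reversal_step\<^sup>*\<^sup>* \<sigma> \<tau>"
  shows "reversal_step\<^sup>*\<^sup>* (x # \<sigma>) (x # \<tau>)"
  using assms
proof induction
  case (step \<tau> \<rho>)
  then have "reversal_step (x # \<tau>) (x # \<rho>)"
    unfolding reversal_step_def by (metis append_Cons)
  then show ?case using step.IH by (rule rtranclp.rtrancl_into_rtrancl[rotated])
qed simp

text \<open>
  Sorting from the left: if the entry \<open>\<plusminus>t\<close> stands at some place with sign opposite to the wanted one,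
  reversing everything up to it moves it to the front as \<open>t\<close>; otherwise its sign is first changed by a
  reversal of length one.
\<close>

lemma reversal_step_connected:
  assumes "mset (map abs \<sigma>) = mset (map abs \<tau>)"
  shows "reversal_step\<^sup>*\<^sup>* \<sigma> \<tau>"
  using assms
proof (induction \<tau> arbitrary: \<sigma>)
  case (Cons t \<tau>)
  have "\<bar>t\<bar> \<in> set (map abs \<sigma>)" using mset_eq_setD[OF Cons.prems] by simp
  then obtain s where s: "s \<in> set \<sigma>" "\<bar>s\<bar> = \<bar>t\<bar>" by auto
  then obtain xs zs where \<sigma>: "\<sigma> = xs @ s # zs" by (meson split_list)
  let ?\<rho> = "map uminus (rev xs) @ zs"
  have step1: "reversal_step (xs @ (- t) # zs) (t # ?\<rho>)"
    unfolding reversal_step_def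
    by (intro exI[of _ "[]"] exI[of _ "xs @ [- t]"] exI[of _ zs]) simp
  have "s = t \<or> s = - t" using s(2) by (auto simp: abs_eq_iff)
  then have "reversal_step\<^sup>*\<^sup>* \<sigma> (t # ?\<rho>)"
  proof
    assume "s = t"
    then have "reversal_step \<sigma> (xs @ (- t) # zs)"
      unfolding reversal_step_def \<sigma>
      by (intro exI[of _ xs] exI[of _ "[t]"] exI[of _ zs]) simp
    then show ?thesis using step1 by (meson converse_rtranclp_into_rtranclp r_into_rtranclp)
  next
    assume "s = - t"
    then show ?thesis using step1 \<sigma> by auto
  qed
  moreover have "mset (map abs ?\<rho>) = mset (map abs \<tau>)"
    using Cons.prems s(2) \<sigma> by (simp add: multiset.map_comp o_def)
  then have "reversal_step\<^sup>*\<^sup>* (t # ?\<rho>) (t # \<tau>)" using Cons.IH reversal_step_Cons by blast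
  ultimately show ?case by (rule rtranclp_trans)
qed simp

lemma SR_connected:
  assumes "\<sigma> \<in> pverts (SR k)" "\<tau> \<in> pverts (SR k)"
  shows "(\<sigma>, \<tau>) \<in> (parcs (SR k))\<^sup>*"
proof -
  have \<sigma>: "\<sigma> \<in> signed_perms k" and "\<tau> \<in> signed_perms k" using assms by (simp_all add: SR_def)
  then have "reversal_step\<^sup>*\<^sup>* \<sigma> \<tau>"
    by (intro reversal_step_connected) (simp add: signed_perms_iff)
  then have "\<tau> \<in> signed_perms k \<and> (\<sigma>, \<tau>) \<in> (parcs (SR k))\<^sup>*"
  proof induction
    case (step \<tau> \<rho>)
    then have "(\<tau>, \<rho>) \<in> parcs (SR k)" by (simp add: arc_SR_iff)
    then show ?case using step reversal_step_signed_perms by (meson rtrancl.rtrancl_into_rtrancl)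
  qed (use \<sigma> in simp)
  then show ?thesis by simp
qed

lemma verts_box_prod_list: "ss \<in> pverts (box_prod_list Gs) \<longleftrightarrow> list_all2 (\<lambda>s G. s \<in> pverts G) ss Gs"
proof (induction Gs arbitrary: ss)
  case (Cons G Gs)
  then show ?case by (cases ss) (auto simp: relabel_def box_prod_def)
qed simp

lemma arcs_box_prod_list_Cons:
  "(ss, ts) \<in> parcs (box_prod_list (G # Gs)) \<longleftrightarrow>
     (\<exists>g h gs hs. ss = g # gs \<and> ts = h # hs \<and>
        ((g, h) \<in> parcs G \<and> gs \<in> pverts (box_prod_list Gs) \<and> gs = hs \<or>
         g \<in> pverts G \<and> g = h \<and> (gs, hs) \<in> parcs (box_prod_list Gs)))"
  by (simp add: relabel_def box_prod_def map_prod_def image_iff split_def) blast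

lemma arcs_box_prod_list:
  assumes "\<forall>G\<in>set Gs. pair_graph G"
  shows "(ss, ts) \<in> parcs (box_prod_list Gs) \<longleftrightarrow> ss \<in> pverts (box_prod_list Gs) \<and>
    (\<exists>i<length Gs. \<exists>t. (ss ! i, t) \<in> parcs (Gs ! i) \<and> ts = ss[i := t])"
  using assms
proof (induction Gs arbitrary: ss ts)
  case (Cons G Gs)
  then have wf: "g \<in> pverts G" if "(g, h) \<in> parcs G" for g h
    using that pair_wf_digraph.in_arcsD1[of G] unfolding pair_graph_def pair_digraph_def pair_fin_digraph_def
    by auto
  have IH: "(gs, hs) \<in> parcs (box_prod_list Gs) \<longleftrightarrow> gs \<in> pverts (box_prod_list Gs) \<and>
    (\<exists>i<length Gs. \<exists>t. (gs ! i, t) \<in> parcs (Gs ! i) \<and> hs = gs[i := t])" for gs hs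
    using Cons by simp
  show ?case
  proof (cases ss)
    case Nil
    then show ?thesis
      unfolding arcs_box_prod_list_Cons by (simp add: verts_box_prod_list del: box_prod_list.simps)
  next
    case ss: (Cons g gs)
    have verts: "ss \<in> pverts (box_prod_list (G # Gs)) \<longleftrightarrow> g \<in> pverts G \<and> gs \<in> pverts (box_prod_list Gs)"
      by (simp only: verts_box_prod_list ss list_all2_Cons)
    have split: "(\<exists>i<length (G # Gs). Q i) \<longleftrightarrow> Q 0 \<or> (\<exists>i<length Gs. Q (Suc i))" for Q
      by (auto simp: less_Suc_eq_0_disj)
    show ?thesis
      unfolding arcs_box_prod_list_Cons verts split IH unfolding ss
      using wf by auto
  qed
qed simp

lemma box_prod_list_connected:
  assumes "\<And>G x y. G \<in> set Gs \<Longrightarrow> x \<in> pverts G \<Longrightarrow> y \<in> pverts G \<Longrightarrow> (x, y) \<in> (parcs G)\<^sup>*"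
    and "ss \<in> pverts (box_prod_list Gs)" "ts \<in> pverts (box_prod_list Gs)"
  shows "(ss, ts) \<in> (parcs (box_prod_list Gs))\<^sup>*"
  using assms
proof (induction Gs arbitrary: ss ts)
  case (Cons G Gs)
  let ?A = "parcs (box_prod_list (G # Gs))"
  obtain g gs where ss: "ss = g # gs" "g \<in> pverts G" "gs \<in> pverts (box_prod_list Gs)"
    using Cons.prems(2) unfolding verts_box_prod_list by (auto simp: list_all2_Cons2)
  obtain h hs where ts: "ts = h # hs" "h \<in> pverts G" "hs \<in> pverts (box_prod_list Gs)"
    using Cons.prems(3) unfolding verts_box_prod_list by (auto simp: list_all2_Cons2)
  have "(g, h) \<in> (parcs G)\<^sup>*" using Cons.prems(1) ss ts by simp
  then have "(g # gs, h # gs) \<in> ?A\<^sup>*"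
  proof induction
    case (step x y)
    have "(x # gs, y # gs) \<in> ?A"
      unfolding arcs_box_prod_list_Cons using step.hyps(2) ss(3) by simp
    then show ?case using step.IH by (rule rtrancl.rtrancl_into_rtrancl[rotated])
  qed simp
  also have "(gs, hs) \<in> (parcs (box_prod_list Gs))\<^sup>*" using Cons ss ts by simp
  then have "(h # gs, h # hs) \<in> ?A\<^sup>*"
  proof induction
    case (step xs ys)
    have "(h # xs, h # ys) \<in> ?A"
      unfolding arcs_box_prod_list_Cons using step.hyps(2) ts(2) by simp
    then show ?case using step.IH by (rule rtrancl.rtrancl_into_rtrancl[rotated])
  qed simp
  finally show ?case using ss ts by simp
qed simp

section \<open>Signed permutations as coordinates of a component\<close>

text \<open>
  The label \<open>x\<close> stands for the dart at position \<open>\<bar>x\<bar>\<close> of the reference cycle, traversed backwards when \<open>x\<close> is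
  negative. Position 0 holds the starting dart, which has no label.
\<close>

definition dart :: "vertex list \<Rightarrow> int \<Rightarrow> vertex" where
  "dart b x = (if x > 0 then b ! nat x else opp (b ! nat (- x)))"

definition rearrange :: "vertex list \<Rightarrow> int list \<Rightarrow> vertex list" where
  "rearrange b \<sigma> = hd b # map (dart b) \<sigma>"

lemma dart_uminus: "x \<noteq> 0 \<Longrightarrow> dart b (- x) = opp (dart b x)"
  by (auto simp: dart_def)

lemma fst_dart: "fst (dart b x) = fst (b ! nat \<bar>x\<bar>)"
  by (auto simp: dart_def)

lemma map_dart_reversed:
  assumes "0 \<notin> set ys"
  shows "map (dart b) (map uminus (rev ys)) = turned (map (dart b) ys)"
  using assms by (auto simp: turned_def rev_map intro!: dart_uminus)

lemma tl_eq_map_nth: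
  assumes "b \<noteq> []"
  shows "tl b = map (\<lambda>x. b ! nat x) [1..int (length b - 1)]"
  using assms by (intro nth_equalityI) (auto simp: nth_tl nat_add_distrib)

lemma rearrange_identity:
  assumes "b \<noteq> []"
  shows "rearrange b [1..int (length b - 1)] = b"
proof -
  have "map (dart b) [1..int (length b - 1)] = tl b"
    unfolding tl_eq_map_nth[OF assms] by (auto simp: dart_def)
  then show ?thesis using assms by (simp add: rearrange_def)
qed

lemma mset_rearrange:
  assumes "b \<noteq> []" "\<sigma> \<in> signed_perms (length b - 1)"
  shows "image_mset fst (mset (rearrange b \<sigma>)) = image_mset fst (mset b)"
proof -
  let ?f = "\<lambda>x. fst (b ! nat x)"
  have "image_mset fst (mset (map (dart b) \<sigma>)) = image_mset ?f (mset (map abs \<sigma>))"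
    by (simp add: multiset.map_comp o_def fst_dart)
  also have "\<dots> = image_mset ?f (mset [1..int (length b - 1)])"
    using assms(2) unfolding signed_perms_iff by simp
  also have "\<dots> = image_mset fst (mset (tl b))"
    unfolding tl_eq_map_nth[OF assms(1)] by (simp add: multiset.map_comp o_def)
  finally have "image_mset fst (mset (rearrange b \<sigma>)) = image_mset fst (mset (hd b # tl b))"
    by (simp add: rearrange_def)
  then show ?thesis using assms(1) by simp
qed

lemma inj_on_dart:
  assumes "distinct (map fst b)"
  shows "inj_on (dart b) {x. x \<noteq> 0 \<and> nat \<bar>x\<bar> < length b}"
proof (rule inj_onI)
  fix x y assume x: "x \<in> {x. x \<noteq> 0 \<and> nat \<bar>x\<bar> < length b}" and y: "y \<in> {x. x \<noteq> 0 \<and> nat \<bar>x\<bar> < length b}"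
    and eq: "dart b x = dart b y"
  have "fst (b ! nat \<bar>x\<bar>) = fst (b ! nat \<bar>y\<bar>)" using arg_cong[OF eq, of fst] by (simp add: fst_dart)
  then have "nat \<bar>x\<bar> = nat \<bar>y\<bar>" using assms x y by (simp add: distinct_conv_nth) metis
  then have "y = x \<or> y = - x" by auto
  then show "x = y" using eq x dart_uminus[of x b] by auto
qed

lemma rearrange_inject:
  assumes "distinct (map fst b)" "b \<noteq> []" "\<sigma> \<in> signed_perms (length b - 1)" "\<tau> \<in> signed_perms (length b - 1)"
    and "rearrange b \<sigma> = rearrange b \<tau>"
  shows "\<sigma> = \<tau>"
proof -
  have "set \<rho> \<subseteq> {x. x \<noteq> 0 \<and> nat \<bar>x\<bar> < length b}" if "\<rho> \<in> signed_perms (length b - 1)" for \<rho>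
  proof
    fix x assume "x \<in> set \<rho>"
    then show "x \<in> {x. x \<noteq> 0 \<and> nat \<bar>x\<bar> < length b}"
      using signed_perms_entries[OF that] assms(2) by (cases b) fastforce+
  qed
  then have "inj_on (dart b) (set \<sigma> \<union> set \<tau>)"
    using inj_on_dart[OF assms(1)] assms(3,4) by (meson Un_least inj_on_subset)
  then show ?thesis using assms(5) inj_on_map_eq_map[of "dart b" \<sigma> \<tau>] by (simp add: rearrange_def)
qed

text \<open>
  The cycles of one matching, each with the chosen starting dart and direction, serve as the origin of the
  coordinates.
\<close>

locale reference_cycles =
  fixes n :: nat and css :: "vertex list list"
  assumes sys: "cycle_system n css"
begin

definition SR_product :: "int list list pair_pre_digraph" where
  "SR_product = box_prod_list (map (\<lambda>b. SR (length b - 1)) css)"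

definition arrange :: "int list list \<Rightarrow> vertex list list" where
  "arrange ss = map2 rearrange css ss"

lemma verts_SR_product:
  "ss \<in> pverts SR_product \<longleftrightarrow>
     length ss = length css \<and> (\<forall>i<length css. ss ! i \<in> signed_perms (length (css ! i) - 1))"
  by (auto simp: SR_product_def verts_box_prod_list list_all2_conv_all_nth SR_def)

lemma arcs_SR_product:
  "(ss, ts) \<in> parcs SR_product \<longleftrightarrow> ss \<in> pverts SR_product \<and>
     (\<exists>i<length css. \<exists>t. reversal_step (ss ! i) t \<and> ts = ss[i := t])"
proof -
  have "\<forall>G\<in>set (map (\<lambda>b. SR (length b - 1)) css). pair_graph G" by (simp add: pair_graph_SR)
  then have "(ss, ts) \<in> parcs SR_product \<longleftrightarrow> ss \<in> pverts SR_product \<and>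
      (\<exists>i<length css. \<exists>t. (ss ! i, t) \<in> parcs (SR (length (css ! i) - 1)) \<and> ts = ss[i := t])"
    unfolding SR_product_def by (subst arcs_box_prod_list) (auto cong: conj_cong)
  then show ?thesis unfolding arc_SR_iff verts_SR_product by blast
qed

lemma arrange_nth:
  assumes "ss \<in> pverts SR_product" "i < length css"
  shows "arrange ss ! i = rearrange (css ! i) (ss ! i)"
  using assms by (simp add: arrange_def verts_SR_product)

lemma length_arrange: "ss \<in> pverts SR_product \<Longrightarrow> length (arrange ss) = length css"
  by (simp add: arrange_def verts_SR_product)

lemma block_props:
  assumes "i < length css"
  shows "css ! i \<noteq> []" "distinct (map fst (css ! i))"
  using cycle_system_props(2,3)[OF sys] nth_mem[OF assms] by blast+

lemma map_hd_arrange: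
  assumes "ss \<in> pverts SR_product"
  shows "map hd (arrange ss) = map hd css"
  using assms by (intro nth_equalityI) (auto simp: length_arrange arrange_nth rearrange_def)

lemma cycle_system_arrange:
  assumes "ss \<in> pverts SR_product"
  shows "cycle_system n (arrange ss)" "map length (arrange ss) = map length css"
proof -
  have "map (\<lambda>b. image_mset fst (mset b)) (arrange ss) = map (\<lambda>b. image_mset fst (mset b)) css"
  proof (rule nth_equalityI)
    fix i assume "i < length (map (\<lambda>b. image_mset fst (mset b)) (arrange ss))"
    then have i: "i < length css" using length_arrange[OF assms] by simp
    then have "ss ! i \<in> signed_perms (length (css ! i) - 1)" using assms by (simp add: verts_SR_product)
    then show "map (\<lambda>b. image_mset fst (mset b)) (arrange ss) ! i = map (\<lambda>b. image_mset fst (mset b)) css ! i"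
      using mset_rearrange[OF block_props(1)[OF i]] i length_arrange[OF assms] arrange_nth[OF assms i] by simp
  qed (simp add: length_arrange[OF assms])
  moreover have "image_mset fst (mset (concat xss)) = sum_list (map (\<lambda>b. image_mset fst (mset b)) xss)"
    for xss :: "vertex list list"
    by (induction xss) simp_all
  moreover have "[] \<notin> set (arrange ss)"
    by (auto simp: arrange_def rearrange_def)
  ultimately show "cycle_system n (arrange ss)" using sys by (simp add: cycle_system_def)
  show "map length (arrange ss) = map length css"
  proof (rule nth_equalityI)
    fix i assume "i < length (map length (arrange ss))"
    then have i: "i < length css" using length_arrange[OF assms] by simp
    then have "length (ss ! i) = length (css ! i) - 1"
      using assms length_signed_perms by (simp add: verts_SR_product)
    then show "map length (arrange ss) ! i = map length css ! i"
      using block_props(1)[OF i] i length_arrange[OF assms] arrange_nth[OF assms i] by (simp add: rearrange_def)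
  qed (simp add: length_arrange[OF assms])
qed

definition coord_matching :: "int list list \<Rightarrow> vertex set set" where
  "coord_matching ss = matching_of (arrange ss)"

lemma matching_on_coord_matching:
  assumes "ss \<in> pverts SR_product"
  shows "matching_on ({..<n} \<times> UNIV) (coord_matching ss)"
  unfolding coord_matching_def by (rule matching_on_matching_of[OF cycle_system_arrange(1)[OF assms]])

lemma matching_type_coord_matching:
  assumes "ss \<in> pverts SR_product"
  shows "matching_type n (coord_matching ss) = rev (sort (map length css))"
  unfolding coord_matching_def matching_type_matching_of[OF cycle_system_arrange(1)[OF assms]]
  by (simp add: cycle_system_arrange(2)[OF assms])

lemma inj_on_coord_matching: "inj_on coord_matching (pverts SR_product)"
proof (rule inj_onI)
  fix ss ts assume ss: "ss \<in> pverts SR_product" and ts: "ts \<in> pverts SR_product"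
    and eq: "coord_matching ss = coord_matching ts"
  have arr: "arrange ss = arrange ts"
    by (rule cycle_system_determined[OF cycle_system_arrange(1)[OF ss] cycle_system_arrange(1)[OF ts]])
      (use eq map_hd_arrange ss ts in \<open>simp_all add: coord_matching_def\<close>)
  show "ss = ts"
  proof (rule nth_equalityI)
    show "length ss = length ts" using ss ts by (simp add: verts_SR_product)
    fix i assume "i < length ss"
    then have i: "i < length css" using ss by (simp add: verts_SR_product)
    show "ss ! i = ts ! i"
      by (rule rearrange_inject[OF block_props(2,1)[OF i]])
        (use ss ts i arr arrange_nth[OF ss i] arrange_nth[OF ts i] in \<open>simp_all add: verts_SR_product\<close>)
  qed
qed

lemma coord_matching_identity:
  obtains ss where "ss \<in> pverts SR_product" "coord_matching ss = matching_of css"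
proof
  let ?ss = "map (\<lambda>b. [1..int (length b - 1)]) css"
  show v: "?ss \<in> pverts SR_product"
    by (simp add: verts_SR_product signed_perms_iff o_def) (metis (no_types, lifting) map_idI abs_of_nonneg atLeastAtMost_iff mset_map set_upto zero_le_one order_trans)
  have "arrange ?ss = css"
    by (rule nth_equalityI) (use length_arrange[OF v] arrange_nth[OF v] block_props(1) in \<open>simp_all add: rearrange_identity del: One_nat_def\<close>)
  then show "coord_matching ?ss = matching_of css" by (simp add: coord_matching_def)
qed

lemma arrange_reversal:
  assumes "ss \<in> pverts SR_product" "i < length css" "ss ! i = xs @ ys @ zs" "ys \<noteq> []"
  defines "ts \<equiv> ss[i := xs @ map uminus (rev ys) @ zs]"
    and "f \<equiv> map (dart (css ! i))"
  shows "arrange ss ! i = hd (css ! i) # f xs @ f ys @ f zs"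
    and "arrange ts = (arrange ss)[i := hd (css ! i) # f xs @ turned (f ys) @ f zs]"
    and "(ss, ts) \<in> parcs SR_product"
    and "ts \<in> pverts SR_product"
proof -
  have len: "length ss = length css" using assms(1) by (simp add: verts_SR_product)
  have mem: "ss ! i \<in> signed_perms (length (css ! i) - 1)"
    using assms(1,2) by (simp add: verts_SR_product)
  then have "0 \<notin> set ys" using signed_perms_entries(1)[OF mem] assms(3) by auto
  then have rev: "map (dart (css ! i)) (map uminus (rev ys)) = turned (f ys)"
    unfolding f_def by (rule map_dart_reversed)
  show "arrange ss ! i = hd (css ! i) # f xs @ f ys @ f zs"
    unfolding arrange_nth[OF assms(1,2)] assms(3) by (simp add: rearrange_def f_def)
  have step: "reversal_step (ss ! i) (xs @ map uminus (rev ys) @ zs)"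
    unfolding reversal_step_def using assms(3,4) by blast
  then show "(ss, ts) \<in> parcs SR_product"
    unfolding arcs_SR_product ts_def using assms(1,2) by blast
  show v: "ts \<in> pverts SR_product"
    using assms(1,2) reversal_step_signed_perms[OF step mem]
    by (auto simp: verts_SR_product ts_def nth_list_update)
  show "arrange ts = (arrange ss)[i := hd (css ! i) # f xs @ turned (f ys) @ f zs]"
  proof (rule nth_equalityI)
    fix j assume "j < length (arrange ts)"
    then have j: "j < length css" using length_arrange[OF v] by simp
    show "arrange ts ! j = (arrange ss)[i := hd (css ! i) # f xs @ turned (f ys) @ f zs] ! j"
    proof (cases "j = i")
      case True
      have "arrange ts ! i = rearrange (css ! i) (xs @ map uminus (rev ys) @ zs)"
        using arrange_nth[OF v assms(2)] assms(2) len by (simp add: ts_def)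
      also have "\<dots> = hd (css ! i) # f xs @ turned (f ys) @ f zs"
        unfolding rearrange_def map_append rev by (simp add: f_def)
      finally show ?thesis using True assms(2) length_arrange[OF assms(1)] by simp
    next
      case False
      then show ?thesis
        using arrange_nth[OF v j] arrange_nth[OF assms(1) j] by (simp add: ts_def)
    qed
  qed (simp add: length_arrange v assms(1))
qed

end

text \<open>
  The path from \<open>x\<close> through \<open>zs\<close> back to \<open>x\<close> and the turned arc keep their inner edges; only the two edges at
  the ends of the arc \<open>ys\<close> change. They are distinct because \<open>hd ys\<close> is an end of only one of them.
\<close>

lemma four_cycle_reversal:
  assumes sys: "cycle_system n css" and i: "i < length css" "css ! i = x # xs @ ys @ zs" "ys \<noteq> []"
    and sys': "cycle_system n (css[i := x # xs @ turned ys @ zs])"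
  shows "four_cycle (sym_diff (matching_of css) (matching_of (css[i := x # xs @ turned ys @ zs])))"
proof -
  let ?b = "x # xs @ turned ys @ zs"
  define P where "P = x # xs"
  define R where "R = zs @ [x]"
  define rest where "rest = remove1 (css ! i) css"
  have b: "css ! i \<in> set css" using i(1) by simp
  have ms: "mset css = mset (css ! i # rest)" using b by (simp add: rest_def)
  have ms': "mset (css[i := ?b]) = mset (?b # rest)" using i(1) ms by (simp add: mset_update)
  let ?N = "links P \<union> links ys \<union> links R \<union> matching_of rest"
  let ?a = "hd ys" and ?b = "opp (last P)" and ?c = "opp (last ys)" and ?d = "hd R"
  have M: "matching_of css = {{?a, ?b}, {?c, ?d}} \<union> ?N"
    unfolding cycle_system_mset_cong(2)[OF ms] i(2)
    using cyc_three_arcs[OF P_def i(3) R_def] by (simp add: P_def Un_assoc insert_commute[of ?a])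
  have M': "matching_of (css[i := x # xs @ turned ys @ zs]) = {{?b, ?c}, {?d, ?a}} \<union> ?N"
    unfolding cycle_system_mset_cong(2)[OF ms']
    using cyc_three_arcs[OF P_def _ R_def, of "turned ys"] i(3)
    by (simp add: P_def hd_turned last_turned links_turned Un_assoc insert_commute[of ?d])
  have dist: "distinct (map fst (x # xs @ ys @ zs))"
    using cycle_system_props(3)[OF sys b] i(2) by simp
  have "?a \<in> set ys" "?d \<in> set (zs @ [x])" using i(3) by (simp_all add: R_def hd_append)
  then have "?a \<noteq> ?d" using dist by auto
  moreover have "?a \<noteq> ?c" using dist i(3) by (cases ys) (auto simp: fst_dart dest: arg_cong[of _ _ fst])
  ultimately have ne: "{?a, ?b} \<noteq> {?c, ?d}" by (auto simp: doubleton_eq_iff)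
  have diff: "(E \<union> N) - E \<subseteq> E' \<union> N" for E E' N :: "vertex set set" by blast
  show ?thesis
    by (rule four_cycle_exchange[OF matching_on_matching_of[OF sys] matching_on_matching_of[OF sys'] _ _ ne];
        unfold M M') (simp, simp, simp, simp, rule diff, rule diff)
qed

context reference_cycles
begin

text \<open>
  A signed reversal of the coordinates turns an arc that avoids the starting dart.
\<close>

lemma arc_is_flip:
  assumes "(ss, ts) \<in> parcs SR_product"
  shows "ts \<in> pverts SR_product" "four_cycle (sym_diff (coord_matching ss) (coord_matching ts))"
proof -
  obtain i t where i: "i < length css" and ss: "ss \<in> pverts SR_product"
    and t: "reversal_step (ss ! i) t" "ts = ss[i := t]"
    using assms unfolding arcs_SR_product by blast
  obtain xs ys zs where ys: "ys \<noteq> []" "ss ! i = xs @ ys @ zs" "t = xs @ map uminus (rev ys) @ zs"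
    using t(1) unfolding reversal_step_def by blast
  note arr = arrange_reversal[OF ss i ys(2,1), folded ys(3), folded t(2)]
  show v: "ts \<in> pverts SR_product" by (rule arr(4))
  show "four_cycle (sym_diff (coord_matching ss) (coord_matching ts))"
    unfolding coord_matching_def arr(2)
  proof (rule four_cycle_reversal[OF cycle_system_arrange(1)[OF ss] _ arr(1)])
    show "i < length (arrange ss)" using i length_arrange[OF ss] by simp
    show "map (dart (css ! i)) ys \<noteq> []" using ys(1) by simp
    show "cycle_system n ((arrange ss)[i := hd (css ! i) # map (dart (css ! i)) xs @
        turned (map (dart (css ! i)) ys) @ map (dart (css ! i)) zs])"
      using cycle_system_arrange(1)[OF v] unfolding arr(2) .
  qed
qed

text \<open>
  The length of the type is the number of cycles, so equality of lengths excludes merging and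
  splitting. What remains is the reversal of an arc of one cycle, which is pulled back to the labels.
\<close>

lemma flip_is_arc:
  assumes ss: "ss \<in> pverts SR_product" and M': "matching_on ({..<n} \<times> UNIV) M'"
    and flip: "four_cycle (sym_diff (coord_matching ss) M')"
    and type: "length (matching_type n M') = length css"
  obtains ts where "(ss, ts) \<in> parcs SR_product" "coord_matching ts = M'"
proof -
  note sys_ss = cycle_system_arrange(1)[OF ss]
  obtain a b c d where ex: "{a, b} \<in> coord_matching ss" "{c, d} \<in> coord_matching ss" "{a, b} \<noteq> {c, d}"
    "M' = coord_matching ss - {{a, b}, {c, d}} \<union> {{b, c}, {d, a}}"
    using four_cycle_sym_diff_exchange[OF matching_on_coord_matching[OF ss] M' flip] .
  show ?thesis
  proof (rule flip_of_cycle_system[OF sys_ss ex(1,2)[unfolded coord_matching_def] ex(3) M'])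
    show "M' \<subseteq> matching_of (arrange ss) - {{a, b}, {c, d}} \<union> {{b, c}, {d, a}}"
      using ex(4) by (simp add: coord_matching_def)
  next
    fix css' assume css': "cycle_system n css'" "matching_of css' = M'" "length css' \<noteq> length (arrange ss)"
    have "length (matching_type n M') = length css'"
      using matching_type_matching_of[OF css'(1)] css'(2) by simp
    then show thesis using css'(3) type length_arrange[OF ss] by simp
  next
    fix i x xs ys zs
    assume i: "i < length (arrange ss)" and split: "arrange ss ! i = x # xs @ ys @ zs" "ys \<noteq> []"
      and new: "matching_of ((arrange ss)[i := x # xs @ turned ys @ zs]) = M'"
    have i': "i < length css" using i length_arrange[OF ss] by simp
    have x: "x = hd (css ! i)" and map: "map (dart (css ! i)) (ss ! i) = xs @ ys @ zs"
      using split(1) unfolding arrange_nth[OF ss i'] rearrange_def by simp_all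
    obtain us r where us: "ss ! i = us @ r" "map (dart (css ! i)) us = xs" "map (dart (css ! i)) r = ys @ zs"
      using map_eq_append_conv[THEN iffD1, OF map] by metis
    then obtain vs ws where "r = vs @ ws" "map (dart (css ! i)) vs = ys" "map (dart (css ! i)) ws = zs"
      using map_eq_append_conv[THEN iffD1, OF us(3)] by metis
    with us have uvw: "ss ! i = us @ vs @ ws" "map (dart (css ! i)) us = xs"
      "map (dart (css ! i)) vs = ys" "map (dart (css ! i)) ws = zs" by simp_all
    have "vs \<noteq> []" using split(2) uvw(3) by auto
    note arr = arrange_reversal[OF ss i' uvw(1) this, unfolded uvw(2-4), folded x]
    show thesis using that[OF arr(3)] new arr(2) by (simp add: coord_matching_def)
  qed
qed

lemma SR_product_connected:
  assumes "ss \<in> pverts SR_product" "ts \<in> pverts SR_product"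
  shows "(ss, ts) \<in> (parcs SR_product)\<^sup>*"
  using assms unfolding SR_product_def by (rule box_prod_list_connected[rotated]) (auto intro: SR_connected)

end

section \<open>Components of a flip graph restricted to a type\<close>

text \<open>
  Without parallel arcs an isomorphism is given by its effect on the vertices alone.
\<close>

lemma digraph_iso_with_proj:
  fixes C :: "('a, 'a \<times> 'a) pre_digraph"
  assumes "wf_digraph C" "tail C = fst" "head C = snd" "pair_wf_digraph P"
    and "inj_on h (pverts P)" "verts C = h ` pverts P" "arcs C = map_prod h h ` parcs P"
  shows "digraph_iso C (with_proj P)"
proof -
  define g where "g = the_inv_into (pverts P) h"
  have gh: "g (h x) = x" if "x \<in> pverts P" for x
    unfolding g_def by (rule the_inv_into_f_f[OF assms(5) that])
  let ?f = "\<lparr>iso_verts = g, iso_arcs = map_prod g g, iso_head = snd, iso_tail = fst\<rparr>"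
  have gh_arc: "map_prod g g (map_prod h h e) = e" if "e \<in> parcs P" for e
    using gh pair_wf_digraph.arc_fst_in_verts[OF assms(4) that] pair_wf_digraph.arc_snd_in_verts[OF assms(4) that]
    by (cases e) simp
  have "pre_digraph.digraph_isomorphism C ?f"
    unfolding pre_digraph.digraph_isomorphism_def
  proof (intro conjI)
    show "inj_on (iso_verts ?f) (verts C)"
      unfolding assms(6) by (rule inj_onI) (auto simp: gh)
    show "inj_on (iso_arcs ?f) (arcs C)"
      unfolding assms(7) by (rule inj_on_inverseI[of _ "map_prod h h"]) (erule imageE, simp add: gh_arc del: map_prod_simp)
  qed (use assms(1-3) in auto)
  moreover have "with_proj P = app_iso ?f C"
  proof -
    have "g ` h ` pverts P = pverts P" using gh by (force simp: image_image)
    moreover have "map_prod g g ` map_prod h h ` parcs P = parcs P"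
      using gh_arc by (force simp: image_image simp del: map_prod_simp)
    ultimately show ?thesis
      by (simp add: with_proj_def app_iso_def assms(6,7))
  qed
  ultimately show ?thesis unfolding digraph_iso_def by blast
qed

theorem proposition3p5:
  fixes n :: nat and ls :: "nat list"
    and C :: "(vertex set set, vertex set set \<times> vertex set set) pre_digraph"
  assumes "n \<ge> 1"
    and "is_partition n ls"
    and "C \<in> pre_digraph.sccs
               (with_proj (flip_graph (complete_graph_2n n))
                  \<restriction> {M. perfect_matching (complete_graph_2n n) M \<and> matching_type n M = ls})"
  shows "digraph_iso C (with_proj (box_prod_list (map (\<lambda>l. SR (l - 1)) ls)))"
proof -
  let ?F = "flip_graph (complete_graph_2n n)"
  define T where "T = {M. perfect_matching (complete_graph_2n n) M \<and> matching_type n M = ls}"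
  define H where "H = with_proj ?F \<restriction> T"
  interpret F: pair_graph ?F
    by (rule pair_graph_flip_graph[OF pair_graph_complete_graph_2n])
  interpret H: wf_digraph H
    unfolding H_def T_def by (rule F.wellformed_induce_subgraph)
  have T: "M \<in> T \<longleftrightarrow> matching_on ({..<n} \<times> UNIV) M \<and> matching_type n M = ls" for M
    by (simp add: T_def perfect_matching_complete_graph_2n)
  have verts_H: "verts H = T" by (simp add: H_def)
  have arcs_H: "arcs H = {(M, M'). M \<in> T \<and> M' \<in> T \<and> four_cycle (sym_diff M M')}"
    by (auto simp: H_def flip_graph_def T_def)
  have proj_H: "tail H = fst" "head H = snd" by (simp_all add: H_def)
  have arcs_ends_H: "arcs_ends H = arcs H"
    by (simp add: arcs_ends_def arc_to_ends_def proj_H)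
  have C: "C \<in> H.sccs" using assms(3) by (simp add: H_def T_def)
  then have ind: "induced_subgraph C H" and "strongly_connected C" by auto
  then have subg: "subgraph C H" and ne: "verts C \<noteq> {}" by (auto simp: strongly_connected_def)
  have proj_C: "tail C = fst" "head C = snd" and wf_C: "wf_digraph C" and verts_C: "verts C \<subseteq> T"
    using subg proj_H verts_H by (auto simp: subgraph_def compatible_def)
  have arcs_C: "arcs C = {(M, M'). M \<in> verts C \<and> M' \<in> verts C \<and> four_cycle (sym_diff M M')}"
    using ind verts_C by (auto simp: induced_subgraph_def arcs_ends_H arcs_H proj_H)
  have scc_C: "verts C \<in> H.sccs_verts" using H.in_sccs_vertsI_sccs C by blast

  \<comment> \<open>The cycles of one matching of the component become the origin of the coordinates; they are sorted by length to fit the order of the factors.\<close>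
  obtain M1 where M1: "M1 \<in> verts C" using ne by blast
  then have M1': "matching_on ({..<n} \<times> UNIV) M1" "matching_type n M1 = ls" using verts_C T by auto
  obtain css0 where css0: "cycle_system n css0" "matching_of css0 = M1"
    using cycle_system_of_matching[OF M1'(1)] .
  define css where "css = rev (sort_key length css0)"
  have ms: "mset css = mset css0" by (simp add: css_def)
  interpret R: reference_cycles n css
    by unfold_locales (use css0 cycle_system_mset_cong(1)[OF ms] in simp)
  have "map length (sort_key length css0) = sort (map length css0)"
    by (rule properties_for_sort[symmetric]) simp_all
  then have len: "map length css = ls"
    using matching_type_matching_of[OF css0(1)] css0(2) M1'(2) by (simp add: css_def flip: rev_map)
  then have sorted: "rev (sort (map length css)) = ls"
    using matching_type_matching_of[OF R.sys] cycle_system_mset_cong(2)[OF ms] css0(2) M1'(2) by simp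
  have prod: "R.SR_product = box_prod_list (map (\<lambda>l. SR (l - 1)) ls)"
    unfolding R.SR_product_def len[symmetric] by (simp add: o_def)
  let ?I = "R.coord_matching ` pverts R.SR_product"
  obtain s1 where s1: "s1 \<in> pverts R.SR_product" "R.coord_matching s1 = M1"
    using R.coord_matching_identity cycle_system_mset_cong(2)[OF ms] css0(2) by metis
  have in_T: "R.coord_matching ss \<in> T" if "ss \<in> pverts R.SR_product" for ss
    using R.matching_on_coord_matching[OF that] R.matching_type_coord_matching[OF that] sorted T by simp

  \<comment> \<open>The image of the coordinates is connected and closed under flips inside the type, hence a component.\<close>
  have reach: "R.coord_matching ss \<rightarrow>\<^sup>*\<^bsub>H\<^esub> R.coord_matching ts"
    if "ss \<in> pverts R.SR_product" "ts \<in> pverts R.SR_product" for ss ts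
    using R.SR_product_connected[OF that]
  proof induction
    case base
    then show ?case using in_T[OF that(1)] verts_H by simp
  next
    case (step us vs)
    then have us: "us \<in> pverts R.SR_product" by (simp add: R.arcs_SR_product)
    have "(R.coord_matching us, R.coord_matching vs) \<in> arcs_ends H"
      using R.arc_is_flip[OF step.hyps(2)] in_T us by (simp add: arcs_ends_H arcs_H)
    then show ?case using step.IH by (rule H.reachable_adj_trans[rotated])
  qed
  have closed: "M' \<in> ?I" if "M \<rightarrow>\<^sup>*\<^bsub>H\<^esub> M'" "M \<in> ?I" for M M'
    using that
  proof (induction rule: H.reachable_induct)
    case (step M' M'')
    then obtain ss where ss: "ss \<in> pverts R.SR_product" "M' = R.coord_matching ss" by blast
    have flip: "M'' \<in> T" "four_cycle (sym_diff M' M'')"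
      using step.hyps by (auto simp: arcs_ends_H arcs_H)
    obtain ts where "(ss, ts) \<in> parcs R.SR_product" "R.coord_matching ts = M''"
      by (rule R.flip_is_arc[OF ss(1), of M''])
        (use ss(2) T flip in \<open>simp_all add: len[symmetric]\<close>)
    then show ?case using R.arc_is_flip(1) by blast
  qed
  have verts_eq: "verts C = ?I"
  proof (intro equalityI subsetI)
    fix M assume "M \<in> verts C"
    then have "M1 \<rightarrow>\<^sup>*\<^bsub>H\<^esub> M" using scc_C M1 unfolding H.in_sccs_verts_conv_reachable by blast
    then show "M \<in> ?I" using closed[OF _ imageI[OF s1(1)]] s1(2) by simp
  next
    fix M assume "M \<in> ?I"
    then have "M1 \<rightarrow>\<^sup>*\<^bsub>H\<^esub> M" "M \<rightarrow>\<^sup>*\<^bsub>H\<^esub> M1" using reach s1 by auto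
    then show "M \<in> verts C" using scc_C M1 unfolding H.in_sccs_verts_conv_reachable by blast
  qed
  have arcs_eq: "arcs C = map_prod R.coord_matching R.coord_matching ` parcs R.SR_product"
  proof (intro equalityI subsetI)
    fix e assume "e \<in> arcs C"
    then obtain M M' where e: "e = (M, M')" "M \<in> verts C" "M' \<in> verts C" "four_cycle (sym_diff M M')"
      unfolding arcs_C by auto
    then have "M' \<in> T" "M \<in> ?I" using verts_C verts_eq by auto
    then obtain ss where ss: "ss \<in> pverts R.SR_product" "M = R.coord_matching ss" by blast
    obtain ts where "(ss, ts) \<in> parcs R.SR_product" "R.coord_matching ts = M'"
      by (rule R.flip_is_arc[OF ss(1), of M'])
        (use ss(2) T e(4) \<open>M' \<in> T\<close> in \<open>simp_all add: len[symmetric]\<close>)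
    then show "e \<in> map_prod R.coord_matching R.coord_matching ` parcs R.SR_product"
      using e ss by force
  next
    fix e assume "e \<in> map_prod R.coord_matching R.coord_matching ` parcs R.SR_product"
    then obtain ss ts where e: "e = (R.coord_matching ss, R.coord_matching ts)" "(ss, ts) \<in> parcs R.SR_product"
      by auto
    then show "e \<in> arcs C"
      unfolding arcs_C verts_eq using R.arc_is_flip[OF e(2)] by (auto simp: R.arcs_SR_product)
  qed
  have "pair_graph R.SR_product"
    unfolding R.SR_product_def by (rule pair_graph_box_prod_list) (simp add: pair_graph_SR)
  then have "pair_wf_digraph R.SR_product"
    by (simp add: pair_graph_def pair_digraph_def pair_fin_digraph_def)
  then have "digraph_iso C (with_proj R.SR_product)"
    using digraph_iso_with_proj[OF wf_C proj_C _ R.inj_on_coord_matching verts_eq arcs_eq] by blast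
  then show ?thesis unfolding prod .
qed

end
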